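(* Let $R>0$ and let $g\colon[a,b]\to\mathbb{R}^2$ be an injective $R$-path. For $x=g(t)$, $t\in[a,b]$, put $g_x=g([a,t])$. Assume that for every $x\in g([a,b])$, $g_x\subseteq B(x,R)$. Then, for every $x\in g([a,b])$, the measure of $\mathrm{Nor}(\mathrm{co}_R(g_x),x)\cap\mathbb{S}^1$ is greater than or equal to $\frac{\pi}{2}$.
   Context: Notation: $B(z,\rho)$ is the open disk in $\mathbb{R}^2$ of center $z$ and radius $\rho$, and $\mathbb{S}^1$ is the unit circle, with measure given by arc length. For a nonempty closed set $K\subset\mathbb{R}^2$ and $q\in K$, the tangent cone is $$\mathrm{Tan}(K,q)=\{v\in\mathbb{R}^2:\forall\varepsilon>0\ \exists x\in K,\ r>0\text{ with }|x-q|<\varepsilon,\ |r(x-q)-v|<\varepsilon\},$$ and the normal cone is $\mathrm{Nor}(K,q)=\{u\in\mathbb{R}^2:\langle u,v\rangle\le0\ \forall v\in\mathrm{Tan}(K,q)\}$. Reach: for a closed set $A$ and $a\in A$, $\mathrm{reach}(A,a)$ is the supremum of all $\rho$ such that every $x\in B(a,\rho)$ has a unique nearest point in $A$; $\mathrm{reach}(A)=\inf_{a\in A}\mathrm{reach}(A,a)$. $R$-hull: for a closed set $A\subset\mathbb{R}^2$, $\mathrm{co}_R(A)$ is, if it exists, the closed set containing $A$ with $\mathrm{reach}(\mathrm{co}_R(A))\ge R$ that is contained in every closed set $B\supseteq A$ with $\mathrm{reach}(B)\ge R$. When it exists, $\mathrm{co}_R(A)$ is the intersection of the complements of all open disks of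 radius $R$ disjoint from $A$. It is known to exist when $A$ is a closed connected subset of an open disk of radius $R$ (which is the case for $A=g_x$ here). $R$-path: let $R>0$. A continuous map $g\colon[a,b]\to\mathbb{R}^2$ with $g(a)\ne g(b)$ is an $R$-path if for every $t\in[a,b]$, writing $x=g(t)$, and for every unit vector $l\in\big[-\mathrm{Tan}(g([a,t]),x)\big]\cup\mathrm{Tan}(g([t,b]),x)$, one has $g([a,t])\cap B(x+Rl,R)=\varnothing$. *)

theory Defs
  imports "HOL-Analysis.Analysis"
begin

definition tangent_cone :: "'a::real_inner set \<Rightarrow> 'a \<Rightarrow> 'a set" where
  "tangent_cone K q =
     {v. \<forall>\<epsilon>>0. \<exists>x\<in>K. \<exists>r>0. norm (x - q) < \<epsilon> \<and> norm (r *\<^sub>R (x - q) - v) < \<epsilon>}"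

definition normal_cone :: "'a::real_inner set \<Rightarrow> 'a \<Rightarrow> 'a set" where
  "normal_cone K q = {u. \<forall>v\<in>tangent_cone K q. u \<bullet> v \<le> 0}"

definition nearest_point :: "'a::metric_space set \<Rightarrow> 'a \<Rightarrow> 'a \<Rightarrow> bool" where
  "nearest_point A x y \<longleftrightarrow> y \<in> A \<and> (\<forall>z\<in>A. dist x y \<le> dist x z)"

text \<open>The reach is extended-real valued, since it is infinite for instance for convex sets.
  The radius \<open>\<rho> = 0\<close> always qualifies (empty ball), so that a supremum over no positive
  radius is \<open>0\<close>.\<close>

definition reach_at :: "'a::metric_space set \<Rightarrow> 'a \<Rightarrow> ereal" where
  "reach_at A a = Sup {ereal \<rho> |\<rho>. 0 \<le> \<rho> \<and> (\<forall>x\<in>ball a \<rho>. \<exists>!y. nearest_point A x y)}"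

definition reach :: "'a::metric_space set \<Rightarrow> ereal" where
  "reach A = (INF a\<in>A. reach_at A a)"

definition is_R_hull :: "real \<Rightarrow> 'a::metric_space set \<Rightarrow> 'a set \<Rightarrow> bool" where
  "is_R_hull R A C \<longleftrightarrow>
     closed C \<and> A \<subseteq> C \<and> reach C \<ge> ereal R \<and>
     (\<forall>B. closed B \<and> A \<subseteq> B \<and> reach B \<ge> ereal R \<longrightarrow> C \<subseteq> B)"

text \<open>An unspecified set if \<open>A\<close> admits no \<open>R\<close>-hull: a claim about \<open>R_hull R A\<close>
  therefore requires showing that the hull exists.\<close>

definition R_hull :: "real \<Rightarrow> 'a::metric_space set \<Rightarrow> 'a set" where
  "R_hull R A = (THE C. is_R_hull R A C)"

lemma is_R_hull_unique: "is_R_hull R A C \<Longrightarrow> is_R_hull R A D \<Longrightarrow> C = D"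
  unfolding is_R_hull_def by blast

lemma R_hull_eqI: "is_R_hull R A C \<Longrightarrow> R_hull R A = C"
  unfolding R_hull_def by (rule the_equality, assumption, erule is_R_hull_unique)

definition R_path :: "real \<Rightarrow> real \<Rightarrow> real \<Rightarrow> (real \<Rightarrow> 'a::real_inner) \<Rightarrow> bool" where
  "R_path R a b g \<longleftrightarrow>
     a \<le> b \<and> continuous_on {a..b} g \<and> g a \<noteq> g b \<and>
     (\<forall>t\<in>{a..b}.
        \<forall>l \<in> uminus ` tangent_cone (g ` {a..t}) (g t) \<union> tangent_cone (g ` {t..b}) (g t).
          norm l = 1 \<longrightarrow> g ` {a..t} \<inter> ball (g t + R *\<^sub>R l) R = {})"

text \<open>The arc length of a subset of the unit circle is the Lebesgue measure of its set
  of angles.\<close>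

definition arc_length :: "(real^2) set \<Rightarrow> real" where
  "arc_length E = measure lebesgue {\<theta> \<in> {0..<2*pi}. vector [cos \<theta>, sin \<theta>] \<in> E}"

end

theory Submission
  imports Defs
begin

text \<open>
  The \<open>R\<close>-hull of a compact connected set \<open>K\<close> in an open \<open>R\<close>-disk is the complement \<open>D\<close> of the union
  of the open \<open>R\<close>-disks missing \<open>K\<close>. If \<open>B \<supseteq> K\<close> has reach at least \<open>R\<close>, a point outside \<open>B\<close> can be
  pushed away from its nearest point up to distance \<open>R\<close>, so it lies in an \<open>R\<close>-disk missing \<open>B\<close>. If a
  point had two nearest points in \<open>D\<close> at distance less than \<open>R\<close>, then two overlapping \<open>R\<close>-disks missing
  \<open>K\<close>, on either side of the chord between these points, would separate them, although \<open>K\<close> is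
  connected.

  Call a unit vector \<open>u\<close> free at time \<open>t\<close> if the disk \<open>B(g t + R u, R)\<close> misses \<open>g [a, t]\<close>; free
  vectors are normal to the hull at \<open>g t\<close>. The tangents of an \<open>R\<close>-path are free, and a free direction
  stays free as long as it makes acute angles with all tangents. If all free directions at time \<open>t\<close>
  made acute angles with each other, this would confine the free directions at all earlier times to
  those at time \<open>t\<close>, whereas at time \<open>a\<close> every direction is free. So there are two free directions at
  an angle of at least \<open>\<pi> / 2\<close>, and the normal cone is convex.\<close>

subsection \<open>Existence of the hull\<close>

definition far_centers :: "real \<Rightarrow> 'a::metric_space set \<Rightarrow> 'a set" where
  "far_centers R K = {c. \<forall>k\<in>K. R \<le> dist c k}"

definition disk_hull :: "real \<Rightarrow> 'a::metric_space set \<Rightarrow> 'a set" where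
  "disk_hull R K = {z. \<forall>c\<in>far_centers R K. R \<le> dist c z}"

lemma disk_hull_superset: "K \<subseteq> disk_hull R K"
  by (auto simp: disk_hull_def far_centers_def)

lemma closed_disk_hull: "closed (disk_hull R K)"
proof -
  have "disk_hull R K = (\<Inter>c\<in>far_centers R K. {z. R \<le> dist c z})"
    by (auto simp: disk_hull_def)
  moreover have "closed {z. R \<le> dist c z}" for c :: 'a
    by (intro closed_Collect_le continuous_intros)
  ultimately show ?thesis
    by auto
qed

text \<open>A hyperplane that separates \<open>z\<close> strictly from \<open>K\<close> leaves room
  on the side of \<open>z\<close> for an open \<open>R\<close>-ball containing \<open>z\<close> and
  missing \<open>K\<close>, so such a \<open>z\<close> is not in the disk hull.\<close>

lemma disk_hull_subset_convex_hull:
  fixes K :: "'a::euclidean_space set"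
  assumes "compact K" "R > 0"
  shows "disk_hull R K \<subseteq> convex hull K"
proof (rule ccontr)
  assume "\<not> ?thesis"
  then obtain z where z: "z \<in> disk_hull R K" "z \<notin> convex hull K"
    by blast
  have "closed (convex hull K)"
    using assms by (simp add: compact_convex_hull compact_imp_closed)
  from separating_hyperplane_closed_point[OF convex_convex_hull this z(2)]
  obtain a b where ab: "a \<bullet> z < b" "\<And>x. x \<in> convex hull K \<Longrightarrow> b < a \<bullet> x"
    by blast
  show False
  proof (cases "K = {}")
    case True
    then have "z \<in> far_centers R K"
      by (simp add: far_centers_def)
    with z(1) \<open>R > 0\<close> show False
      by (auto simp: disk_hull_def)
  next
    case False
    then have "a \<noteq> 0"
      using ab hull_subset[of K convex] by (metis ex_in_conv inner_zero_left order_less_trans order_less_irrefl subset_iff)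
    \<comment> \<open>The ball reaches \<open>\<gamma>\<close> beyond \<open>z\<close> towards the
      hyperplane: at most the distance from \<open>z\<close> to it, and at most \<open>R\<close>, so
      that \<open>z\<close> is at distance \<open>R - \<gamma>\<close> from the center.\<close>
    define \<gamma> where "\<gamma> = min R ((b - a \<bullet> z) / norm a)"
    have \<gamma>: "0 < \<gamma>" "\<gamma> \<le> R" "\<gamma> * norm a \<le> b - a \<bullet> z"
      using ab(1) \<open>a \<noteq> 0\<close> \<open>R > 0\<close> by (auto simp: \<gamma>_def min_def field_simps)
    define c where "c = z - (R - \<gamma>) *\<^sub>R sgn a"
    have na: "norm (sgn a) = 1"
      using \<open>a \<noteq> 0\<close> by (simp add: norm_sgn)
    have asg: "a \<bullet> sgn a = norm a"
      using \<open>a \<noteq> 0\<close> by (simp add: sgn_div_norm dot_square_norm power2_eq_square)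
    have "R \<le> dist c k" if "k \<in> K" for k
    proof -
      have "b < a \<bullet> k"
        using that ab(2) by (simp add: hull_inc)
      then have "R * norm a \<le> a \<bullet> (k - c)"
        using \<gamma>(3) asg by (simp add: c_def inner_diff_right algebra_simps)
      also have "\<dots> \<le> norm a * norm (k - c)"
        by (rule norm_cauchy_schwarz)
      finally show ?thesis
        using \<open>a \<noteq> 0\<close> by (simp add: dist_norm norm_minus_commute mult.commute)
    qed
    then have "c \<in> far_centers R K"
      by (simp add: far_centers_def)
    then have "R \<le> dist c z"
      using z(1) by (simp add: disk_hull_def)
    moreover have "dist c z = R - \<gamma>"
      using \<gamma> na by (simp add: c_def dist_norm)
    ultimately show False
      using \<gamma> by simp
  qed
qed

section \<open>Nearest points and sets of reach at least \<open>R\<close>\<close>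

lemma reach_unique_nearest:
  assumes "ereal R \<le> reach B" "b \<in> B" "dist p b < R"
  shows "\<exists>!y. nearest_point B p y"
proof -
  have "ereal (dist b p) < reach_at B b"
    using assms by (metis INF_lower dist_commute less_ereal.simps(1) order_less_le_trans reach_def)
  then obtain \<rho> where "dist b p < \<rho>" "\<forall>x\<in>ball b \<rho>. \<exists>!y. nearest_point B x y"
    unfolding reach_at_def by (auto simp: less_Sup_iff)
  then show ?thesis
    by auto
qed

lemma nearest_point_infdist:
  assumes "nearest_point A x y"
  shows "infdist x A = dist x y"
proof -
  have "A \<noteq> {}" "y \<in> A"
    using assms by (auto simp: nearest_point_def)
  moreover have "dist x y \<le> infdist x A"
    using assms \<open>A \<noteq> {}\<close> by (auto simp: infdist_def nearest_point_def intro!: cINF_greatest)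
  ultimately show ?thesis
    by (metis infdist_le order_antisym)
qed

text \<open>Since \<open>infdist\<close> is continuous, this form shows that, for closed
  \<open>A\<close>, being a nearest point is a closed condition on the pair of points.\<close>

lemma nearest_point_iff_infdist:
  "nearest_point A x y \<longleftrightarrow> y \<in> A \<and> dist x y \<le> infdist x A"
  using nearest_point_infdist[of A x y] infdist_le[of _ A x]
  by (force simp: nearest_point_def)

lemma nearest_point_exists:
  fixes A :: "'a::heine_borel set"
  assumes "closed A" "A \<noteq> {}"
  shows "\<exists>y. nearest_point A x y"
  using distance_attains_inf[OF assms, of x] by (metis nearest_point_def)

text \<open>The graph of \<open>\<xi>\<close> is closed by the characterization through
  \<open>infdist\<close>, and its values stay in a fixed ball because \<open>infdist\<close> is
  bounded on the compact set \<open>S\<close>; a map into a compact set with closed graph is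
  continuous.\<close>

lemma continuous_on_nearest_point:
  fixes A :: "'a::euclidean_space set"
  assumes "closed A" "compact S" and \<xi>: "\<And>x. x \<in> S \<Longrightarrow> nearest_point A x (\<xi> x)"
    and uniq: "\<And>x y. x \<in> S \<Longrightarrow> nearest_point A x y \<Longrightarrow> y = \<xi> x"
  shows "continuous_on S \<xi>"
proof -
  obtain r where r: "S \<subseteq> cball 0 r"
    using bounded_subset_ballD[OF compact_imp_bounded[OF \<open>compact S\<close>]] ball_subset_cball
    by (metis subset_trans)
  have "compact ((\<lambda>x. infdist x A) ` S)"
    by (intro compact_continuous_image continuous_intros assms)
  then obtain m where m: "\<And>x. x \<in> S \<Longrightarrow> infdist x A \<le> m"
    by (metis bounded_iff compact_imp_bounded imageI norm_ge_zero real_norm_def abs_le_iff)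
  show ?thesis
  proof (rule continuous_from_closed_graph)
    show "compact (cball (0::'a) (r + m))"
      by simp
    show "\<xi> \<in> S \<rightarrow> cball 0 (r + m)"
    proof
      fix x assume x: "x \<in> S"
      have "norm (\<xi> x) \<le> norm x + dist x (\<xi> x)"
        by (metis dist_commute dist_norm norm_triangle_sub)
      also have "\<dots> \<le> r + m"
        using x r m[OF x] nearest_point_infdist[OF \<xi>[OF x]] by (intro add_mono) auto
      finally show "\<xi> x \<in> cball 0 (r + m)"
        by simp
    qed
    have "(\<lambda>x. (x, \<xi> x)) ` S = (S \<times> A) \<inter> {z. dist (fst z) (snd z) \<le> infdist (fst z) A}"
      using \<xi> uniq by (auto simp: nearest_point_iff_infdist image_iff)
    moreover have "closed \<dots>"
      using \<open>closed A\<close> compact_imp_closed[OF \<open>compact S\<close>]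
      by (intro closed_Int closed_Times closed_Collect_le continuous_intros)
    ultimately show "closed ((\<lambda>x. (x, \<xi> x)) ` S)"
      by simp
  qed
qed

lemma nearest_point_between:
  assumes "nearest_point A x y" "dist x y = dist x z + dist z y"
  shows "nearest_point A z y"
  unfolding nearest_point_def
proof (intro conjI ballI)
  show "y \<in> A"
    using assms(1) by (simp add: nearest_point_def)
  fix w assume "w \<in> A"
  then have "dist x z + dist z y \<le> dist x w"
    using assms by (simp add: nearest_point_def)
  also have "\<dots> \<le> dist x z + dist z w"
    by (rule dist_triangle)
  finally show "dist z y \<le> dist z w"
    by simp
qed

text \<open>Brouwer's theorem produces a point \<open>y\<close> close to \<open>z\<close> such that \<open>z\<close> lies between \<open>y\<close> and
  the nearest point of \<open>y\<close>, which must then be \<open>q\<close>.\<close>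

lemma nearest_point_step:
  fixes A :: "'a::euclidean_space set"
  assumes "closed A" "\<epsilon> > 0" and uniq: "\<And>x. x \<in> cball z \<epsilon> \<Longrightarrow> \<exists>!y. nearest_point A x y"
    and q: "nearest_point A z q" and "z \<notin> A" "cball z \<epsilon> \<inter> A = {}"
  shows "nearest_point A (z + \<epsilon> *\<^sub>R sgn (z - q)) q"
proof -
  define \<xi> where "\<xi> x = (THE y. nearest_point A x y)" for x
  have \<xi>: "nearest_point A x (\<xi> x)" if "x \<in> cball z \<epsilon>" for x
    unfolding \<xi>_def by (rule theI'[OF uniq[OF that]])
  have \<xi>_eq: "y = \<xi> x" if "x \<in> cball z \<epsilon>" "nearest_point A x y" for x y
    using uniq[OF that(1)] \<xi>[OF that(1)] that(2) by blast
  have cont: "continuous_on (cball z \<epsilon>) \<xi>"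
    by (rule continuous_on_nearest_point[OF \<open>closed A\<close> compact_cball]) (use \<xi> \<xi>_eq in auto)
  have nz: "\<xi> x \<noteq> z" if "x \<in> cball z \<epsilon>" for x
    using \<xi>[OF that] \<open>z \<notin> A\<close> by (auto simp: nearest_point_def)
  \<comment> \<open>A fixed point \<open>y\<close> of \<open>f\<close> lies on the ray from
    \<open>\<xi> y\<close> through \<open>z\<close>, at distance \<open>\<epsilon>\<close> beyond
    \<open>z\<close>.\<close>
  define f where "f x = z + \<epsilon> *\<^sub>R sgn (z - \<xi> x)" for x
  have "continuous_on (cball z \<epsilon>) f"
    unfolding f_def sgn_div_norm
    by (intro continuous_intros cont) (use nz in force)
  moreover have "f \<in> cball z \<epsilon> \<rightarrow> cball z \<epsilon>"
    using \<open>\<epsilon> > 0\<close> by (auto simp: f_def dist_norm norm_sgn)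
  ultimately obtain y where y: "y \<in> cball z \<epsilon>" "f y = y"
    using brouwer_ball[OF \<open>\<epsilon> > 0\<close>] by blast
  have nzy: "z - \<xi> y \<noteq> 0"
    using nz[OF y(1)] by simp
  have "y - \<xi> y = (\<epsilon> + norm (z - \<xi> y)) *\<^sub>R sgn (z - \<xi> y)"
    using y(2) nzy by (simp add: f_def sgn_div_norm algebra_simps)
  then have "dist y (\<xi> y) = \<epsilon> + dist z (\<xi> y)"
    using nzy \<open>\<epsilon> > 0\<close> by (simp add: dist_norm norm_sgn)
  moreover have "dist y z = \<epsilon>"
  proof -
    have "y - z = \<epsilon> *\<^sub>R sgn (z - \<xi> y)"
      using y(2) by (simp add: f_def algebra_simps)
    then show ?thesis
      using nzy \<open>\<epsilon> > 0\<close> by (simp add: dist_norm norm_sgn)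
  qed
  ultimately have "nearest_point A z (\<xi> y)"
    by (intro nearest_point_between[OF \<xi>[OF y(1)]]) simp
  then have "\<xi> y = q"
    using uniq[of z] q \<open>\<epsilon> > 0\<close> by auto
  with \<xi>[OF y(1)] y(2) show ?thesis
    by (simp add: f_def)
qed

text \<open>Continuation along the ray from \<open>q\<close> through \<open>z\<close>: the
  parameters up to \<open>\<tau>\<close> at which \<open>q\<close> is still nearest form a compact
  set, and \<open>nearest_point_step\<close> would push its maximum further if it were less than
  \<open>\<tau>\<close>.\<close>

lemma nearest_point_extend:
  fixes B :: "'a::euclidean_space set"
  assumes "closed B" and reach: "ereal R \<le> reach B"
    and q: "nearest_point B z q" and d: "0 < dist z q" "dist z q < R"
  defines "v \<equiv> sgn (z - q)"
  assumes "0 \<le> \<tau>" "\<tau> < R"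
  shows "nearest_point B (q + \<tau> *\<^sub>R v) q"
proof -
  have "q \<in> B"
    using q by (simp add: nearest_point_def)
  have nv: "norm v = 1"
    using d by (simp add: v_def norm_sgn)
  have zq: "z = q + dist z q *\<^sub>R v"
    using d by (simp add: v_def dist_norm sgn_div_norm)
  define T where "T = {t. 0 \<le> t \<and> t \<le> \<tau> \<and> nearest_point B (q + t *\<^sub>R v) q}"
  have T: "T = {0..\<tau>} \<inter> {t. t \<le> infdist (q + t *\<^sub>R v) B}"
    using \<open>q \<in> B\<close> nv by (auto simp: T_def nearest_point_iff_infdist dist_norm)
  have "compact T"
    unfolding T by (intro compact_Int_closed closed_Collect_le continuous_intros compact_Icc)
  moreover have "0 \<in> T"
    using \<open>q \<in> B\<close> \<open>0 \<le> \<tau>\<close> by (simp add: T_def nearest_point_def)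
  ultimately obtain t where t: "t \<in> T" "\<And>t'. t' \<in> T \<Longrightarrow> t' \<le> t"
    using compact_attains_sup[of T] by auto
  have down: "nearest_point B (q + s *\<^sub>R v) q"
    if "nearest_point B (q + s' *\<^sub>R v) q" "0 \<le> s" "s \<le> s'" for s s'
  proof (rule nearest_point_between[OF that(1)])
    have "(q + s' *\<^sub>R v) - (q + s *\<^sub>R v) = (s' - s) *\<^sub>R v"
      by (simp add: algebra_simps)
    then show "dist (q + s' *\<^sub>R v) q = dist (q + s' *\<^sub>R v) (q + s *\<^sub>R v) + dist (q + s *\<^sub>R v) q"
      using that nv by (simp add: dist_norm)
  qed
  have "t = \<tau>"
  proof (rule ccontr)
    assume "t \<noteq> \<tau>"
    with t(1) have tt: "0 \<le> t" "t < \<tau>" "nearest_point B (q + t *\<^sub>R v) q"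
      by (auto simp: T_def)
    \<comment> \<open>\<open>nearest_point_step\<close> applies only off \<open>B\<close>. The
      parameter of \<open>z\<close>, or \<open>\<tau>\<close> if that is smaller, belongs to
      \<open>T\<close> and keeps the maximum positive.\<close>
    have "t > 0"
    proof -
      have "min (dist z q) \<tau> \<in> T"
        using down[of "dist z q" "min (dist z q) \<tau>"] q zq d \<open>0 \<le> \<tau>\<close> by (simp add: T_def)
      from t(2)[OF this] show ?thesis
        using d tt by linarith
    qed
    define w where "w = q + t *\<^sub>R v"
    have dw: "dist w q = t"
      using nv tt by (simp add: w_def dist_norm)
    have idw: "infdist w B = t"
      using nearest_point_infdist[OF tt(3)] dw by (simp add: w_def)
    \<comment> \<open>\<open>\<epsilon> < t\<close> keeps the ball around \<open>w\<close> off
      \<open>B\<close>, and \<open>t + \<epsilon> \<le> \<tau> < R\<close> keeps it in the region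
      around \<open>q\<close> where nearest points are unique.\<close>
    define \<epsilon> where "\<epsilon> = min (t / 2) (\<tau> - t)"
    have \<epsilon>: "0 < \<epsilon>" "\<epsilon> < t" "t + \<epsilon> \<le> \<tau>"
      using \<open>t > 0\<close> tt by (auto simp: \<epsilon>_def min_def)
    have disj: "cball w \<epsilon> \<inter> B = {}"
    proof -
      have False if "x \<in> B" "dist w x \<le> \<epsilon>" for x
        using that infdist_le[OF that(1), of w] idw \<epsilon> by simp
      then show ?thesis
        by auto
    qed
    have "nearest_point B (w + \<epsilon> *\<^sub>R sgn (w - q)) q"
    proof (rule nearest_point_step[OF \<open>closed B\<close> \<epsilon>(1)])
      show "nearest_point B w q"
        using tt by (simp add: w_def)
      show "cball w \<epsilon> \<inter> B = {}"
        by (rule disj)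
      then show "w \<notin> B"
        using \<epsilon> by (metis IntI centre_in_cball empty_iff less_imp_le)
      fix x assume "x \<in> cball w \<epsilon>"
      then have "dist x q \<le> \<epsilon> + t"
        using dist_triangle[of x q w] dw by (simp add: dist_commute)
      then show "\<exists>!y. nearest_point B x y"
        using \<epsilon> \<open>\<tau> < R\<close> by (intro reach_unique_nearest[OF reach \<open>q \<in> B\<close>]) simp
    qed
    moreover have "w + \<epsilon> *\<^sub>R sgn (w - q) = q + (t + \<epsilon>) *\<^sub>R v"
      using nv tt \<open>t > 0\<close> by (simp add: w_def sgn_div_norm algebra_simps)
    ultimately have "t + \<epsilon> \<in> T"
      using \<epsilon> tt by (simp add: T_def)
    from t(2)[OF this] show False
      using \<epsilon> by simp
  qed
  with t(1) show ?thesis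
    by (simp add: T_def)
qed

lemma disk_hull_minimal:
  fixes B :: "'a::euclidean_space set"
  assumes "closed B" "K \<subseteq> B" and reach: "ereal R \<le> reach B" and "K \<noteq> {}" "R > 0"
  shows "disk_hull R K \<subseteq> B"
proof
  fix z assume z: "z \<in> disk_hull R K"
  show "z \<in> B"
  proof (rule ccontr)
    assume "z \<notin> B"
    obtain q where q: "nearest_point B z q"
      using nearest_point_exists[OF \<open>closed B\<close>] assms by blast
    \<comment> \<open>A point at distance at least \<open>R\<close> from \<open>B\<close> is itself
      the center of such a ball; otherwise the center lies at distance \<open>R\<close> from
      \<open>q\<close> on the ray through \<open>z\<close>.\<close>
    have "\<exists>c. (\<forall>b\<in>B. R \<le> dist c b) \<and> dist c z < R"
    proof (cases "dist z q < R")
      case False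
      then have "\<forall>b\<in>B. R \<le> dist z b"
        using q by (auto simp: nearest_point_def intro: order_trans)
      with \<open>R > 0\<close> show ?thesis
        by (intro exI[of _ z]) simp
    next
      case True
      define v where "v = sgn (z - q)"
      have d: "dist z q > 0"
        using q \<open>z \<notin> B\<close> by (auto simp: nearest_point_def)
      have nv: "norm v = 1"
        using d by (simp add: v_def norm_sgn)
      \<comment> \<open>\<open>nearest_point_extend\<close> covers only \<open>\<tau> < R\<close>;
        the bound for \<open>R\<close> itself is the limit from the left.\<close>
      have "R \<le> dist (q + R *\<^sub>R v) b" if "b \<in> B" for b
      proof (rule tendsto_le)
        show "((\<lambda>\<tau>. dist (q + \<tau> *\<^sub>R v) b) \<longlongrightarrow> dist (q + R *\<^sub>R v) b) (at_left R)"
          by (intro tendsto_intros)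
        show "((\<lambda>\<tau>. \<tau>) \<longlongrightarrow> R) (at_left R)"
          by (rule tendsto_ident_at)
        show "\<forall>\<^sub>F \<tau> in at_left R. \<tau> \<le> dist (q + \<tau> *\<^sub>R v) b"
          using eventually_at_left_real[OF \<open>R > 0\<close>]
        proof eventually_elim
          case (elim \<tau>)
          then have "nearest_point B (q + \<tau> *\<^sub>R v) q"
            unfolding v_def by (intro nearest_point_extend[OF \<open>closed B\<close> reach q d True]) auto
          then have "dist (q + \<tau> *\<^sub>R v) q \<le> dist (q + \<tau> *\<^sub>R v) b"
            using that by (simp add: nearest_point_def)
          then show ?case
            using elim nv by (simp add: dist_norm)
        qed
      qed simp
      moreover have "dist (q + R *\<^sub>R v) z = R - dist z q"
      proof -
        have "q + R *\<^sub>R v - z = (R - dist z q) *\<^sub>R v"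
          using d by (simp add: v_def dist_norm sgn_div_norm algebra_simps)
        then show ?thesis
          using nv True by (simp add: dist_norm)
      qed
      ultimately show ?thesis
        using d by (intro exI[of _ "q + R *\<^sub>R v"]) simp
    qed
    then obtain c where c: "\<forall>b\<in>B. R \<le> dist c b" "dist c z < R"
      by blast
    then have "c \<in> far_centers R K"
      using \<open>K \<subseteq> B\<close> by (auto simp: far_centers_def)
    with z c(2) show False
      by (auto simp: disk_hull_def)
  qed
qed

section \<open>Rotation by a right angle and orthonormal frames in the plane\<close>

text \<open>The counterclockwise rotation by a right angle, so that \<open>e\<close> and
  \<open>perp e\<close> form an orthonormal frame for every unit vector \<open>e\<close>.\<close>

definition perp :: "real^2 \<Rightarrow> real^2" where
  "perp v = vector [- (v $ 2), v $ 1]"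

lemma perp_nth [simp]: "perp v $ 1 = - (v $ 2)" "perp v $ 2 = v $ 1"
  by (simp_all add: perp_def)

lemma inner_real2: "(x::real^2) \<bullet> y = x $ 1 * y $ 1 + x $ 2 * y $ 2"
  by (simp add: inner_vec_def sum_2)

lemma vec2_eq_iff: "(x::real^2) = y \<longleftrightarrow> x $ 1 = y $ 1 \<and> x $ 2 = y $ 2"
  by (simp add: vec_eq_iff forall_2)

lemma inner_perp_self [simp]: "v \<bullet> perp v = 0" "perp v \<bullet> v = 0"
  by (simp_all add: inner_real2)

lemma inner_perp_perp [simp]: "perp u \<bullet> perp v = u \<bullet> v"
  by (simp add: inner_real2)

lemma norm_perp [simp]: "norm (perp v) = norm v"
  by (simp add: norm_eq_sqrt_inner)

text \<open>A polynomial identity in the coordinates, kept homogeneous in \<open>e\<close> because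
  it is also used with a vector that is not normalized.\<close>

lemma frame_inner_scaled:
  "(u \<bullet> v) * (e \<bullet> e) = (u \<bullet> e) * (v \<bullet> e) + (u \<bullet> perp e) * (v \<bullet> perp e)"
  by (simp add: inner_real2 algebra_simps)

lemma frame_inner:
  assumes "norm e = 1"
  shows "u \<bullet> v = (u \<bullet> e) * (v \<bullet> e) + (u \<bullet> perp e) * (v \<bullet> perp e)"
  using frame_inner_scaled[of u v e] assms by (simp add: dot_square_norm)

lemma frame_norm:
  assumes "norm e = 1"
  shows "(norm v)\<^sup>2 = (v \<bullet> e)\<^sup>2 + (v \<bullet> perp e)\<^sup>2"
  using frame_inner[OF assms, of v v] unfolding power2_norm_eq_inner by (simp add: power2_eq_square)

lemma frame_expand:
  assumes "norm e = 1"
  shows "v = (v \<bullet> e) *\<^sub>R e + (v \<bullet> perp e) *\<^sub>R perp e"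
proof -
  have "e $ 1 * e $ 1 + e $ 2 * e $ 2 = 1"
    using assms by (simp add: norm_eq_sqrt_inner inner_real2)
  then have "v $ 1 * (e $ 1 * e $ 1 + e $ 2 * e $ 2) = v $ 1" "v $ 2 * (e $ 1 * e $ 1 + e $ 2 * e $ 2) = v $ 2"
    by simp_all
  then show ?thesis
    by (simp add: vec2_eq_iff inner_real2 algebra_simps)
qed

lemma perp_inner_eq_0_imp_scaleR:
  assumes "perp d \<bullet> v = 0" "d \<noteq> 0"
  obtains \<kappa> where "v = \<kappa> *\<^sub>R d"
proof
  have "d \<bullet> d \<noteq> 0"
    using assms by simp
  have "(d \<bullet> d) *\<^sub>R v = (v \<bullet> d) *\<^sub>R d"
    using assms(1) by (simp add: vec2_eq_iff inner_real2) algebra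
  then have "(1 / (d \<bullet> d)) *\<^sub>R ((d \<bullet> d) *\<^sub>R v) = (1 / (d \<bullet> d)) *\<^sub>R ((v \<bullet> d) *\<^sub>R d)"
    by simp
  then show "v = ((v \<bullet> d) / (d \<bullet> d)) *\<^sub>R d"
    using \<open>d \<bullet> d \<noteq> 0\<close> by simp
qed

section \<open>Separation by two disks and uniqueness of nearest points in the disk hull\<close>

text \<open>Squaring the first bound forces \<open>(c - p) \<bullet> d > 0\<close>, squaring the
  second \<open>(c - p) \<bullet> d < 0\<close>. Geometrically, points closer to \<open>p\<close>
  than to \<open>c\<close> cannot lie on both sides of \<open>c\<close> on a line through
  \<open>c\<close>.\<close>

lemma closer_than_beyond_center:
  fixes c d p :: "'a::real_inner"
  assumes "norm (c - \<kappa> *\<^sub>R d - p) < norm (\<kappa> *\<^sub>R d)" "norm (c + \<mu> *\<^sub>R d - p) < norm (\<mu> *\<^sub>R d)"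
    and "0 \<le> \<kappa>" "0 \<le> \<mu>"
  shows False
proof -
  define a where "a = c - p"
  have "norm (a - \<kappa> *\<^sub>R d) < norm (\<kappa> *\<^sub>R d)" "norm (a + \<mu> *\<^sub>R d) < norm (\<mu> *\<^sub>R d)"
    using assms(1,2) by (simp_all add: a_def algebra_simps)
  then have "(norm (a - \<kappa> *\<^sub>R d))\<^sup>2 < (norm (\<kappa> *\<^sub>R d))\<^sup>2" "(norm (a + \<mu> *\<^sub>R d))\<^sup>2 < (norm (\<mu> *\<^sub>R d))\<^sup>2"
    by (simp_all only: power_strict_mono norm_ge_zero pos2)
  then have 1: "a \<bullet> a < \<kappa> * (2 * (a \<bullet> d))" and 2: "a \<bullet> a + \<mu> * (2 * (a \<bullet> d)) < 0"
    unfolding power2_norm_eq_inner by (simp_all add: inner_simps inner_commute algebra_simps)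
  have "0 \<le> a \<bullet> a"
    by simp
  then have "0 < \<kappa> * (2 * (a \<bullet> d))" "\<mu> * (2 * (a \<bullet> d)) < 0"
    using 1 2 by linarith+
  then show False
    using assms(3,4) by (simp add: zero_less_mult_iff mult_less_0_iff)
qed

text \<open>Squared, the condition on the point is a strict linear inequality, whose solutions form
  a convex set.\<close>

lemma closer_convex:
  fixes c p :: "'a::real_inner"
  assumes "norm (x - p) < norm (x - c)" "norm (y - p) < norm (y - c)" "0 \<le> \<nu>" "\<nu> \<le> 1"
  shows "norm ((1 - \<nu>) *\<^sub>R x + \<nu> *\<^sub>R y - p) < norm ((1 - \<nu>) *\<^sub>R x + \<nu> *\<^sub>R y - c)"
proof -
  have iff: "norm (z - p) < norm (z - c) \<longleftrightarrow> z \<in> {z. (2 *\<^sub>R (c - p)) \<bullet> z < c \<bullet> c - p \<bullet> p}" for z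
  proof -
    have "norm (z - p) < norm (z - c) \<longleftrightarrow> (norm (z - p))\<^sup>2 < (norm (z - c))\<^sup>2"
      by (metis norm_ge_zero power2_less_imp_less power_strict_mono pos2)
    also have "\<dots> \<longleftrightarrow> z \<in> {z. (2 *\<^sub>R (c - p)) \<bullet> z < c \<bullet> c - p \<bullet> p}"
      by (simp add: power2_norm_eq_inner inner_simps inner_commute algebra_simps)
    finally show ?thesis .
  qed
  show ?thesis
    using assms convexD_alt[OF convex_halfspace_lt, of x "2 *\<^sub>R (c - p)" "c \<bullet> c - p \<bullet> p" y \<nu>]
    unfolding iff by blast
qed

lemma connected_nonzero_sign:
  fixes f :: "'a::topological_space \<Rightarrow> real"
  assumes "connected S" "continuous_on S f" and nz: "\<And>x. x \<in> S \<Longrightarrow> f x \<noteq> 0"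
  shows "(\<forall>x\<in>S. 0 < f x) \<or> (\<forall>x\<in>S. f x < 0)"
proof (rule ccontr)
  assume "\<not> ?thesis"
  then obtain x y where "x \<in> S" "y \<in> S" "f x \<le> 0" "0 \<le> f y"
    by (auto simp: not_less)
  moreover have "connected (f ` S)"
    using assms by (intro connected_continuous_image)
  ultimately have "0 \<in> f ` S"
    by (meson connectedD_interval imageI)
  then obtain x where "0 = f x" "x \<in> S"
    by (rule imageE)
  with nz[of x] show False
    by simp
qed

text \<open>Two disks missing \<open>K\<close> that overlap across the chord from \<open>x\<^sub>1\<close> to \<open>x\<^sub>2\<close> cut the disk
  around \<open>p\<close> along the line through their centers, so that \<open>K\<close>, and with it its disk hull, lies on
  one side of this line.\<close>

lemma disk_hull_not_separated:
  fixes K :: "(real^2) set"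
  assumes "connected K" "compact K" "K \<subseteq> ball p R" "R > 0"
    and x: "x\<^sub>1 \<in> disk_hull R K" "x\<^sub>2 \<in> disk_hull R K"
    and c: "c \<in> far_centers R K" "c' \<in> far_centers R K" "dist c c' < 2 * R"
    and \<mu>: "0 \<le> \<mu>" "\<mu> \<le> 1" and \<nu>: "0 < \<nu>" "\<nu> < 1"
    and cross: "(1 - \<mu>) *\<^sub>R c + \<mu> *\<^sub>R c' = (1 - \<nu>) *\<^sub>R x\<^sub>1 + \<nu> *\<^sub>R x\<^sub>2"
  shows False
proof -
  define l where "l = (1 - \<nu>) *\<^sub>R x\<^sub>1 + \<nu> *\<^sub>R x\<^sub>2"
  define d where "d = c' - c"
  have l: "l = c + \<mu> *\<^sub>R d" "l = c' + (1 - \<mu>) *\<^sub>R (- d)"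
    using cross by (simp_all add: l_def d_def algebra_simps)
  have hull: "disk_hull R K \<subseteq> convex hull K"
    by (rule disk_hull_subset_convex_hull) fact+
  have hull_p: "disk_hull R K \<subseteq> ball p R"
    using hull hull_minimal[of K "ball p R" convex] assms(3) convex_ball by blast
  \<comment> \<open>Far centers are at distance at least \<open>R\<close> from points of the hull,
    while \<open>p\<close> is at distance less than \<open>R\<close>.\<close>
  have closer: "norm (z - p) < norm (z - e)"
    if "z \<in> disk_hull R K" "e \<in> far_centers R K" for z e
    using that hull_p by (force simp: disk_hull_def dist_norm norm_minus_commute)
  have l_closer: "norm (l - p) < norm (l - e)" if "e \<in> far_centers R K" for e
    unfolding l_def using x \<nu> by (intro closer_convex closer[OF _ that]) auto
  have "d \<noteq> 0"
    using l_closer[OF c(1)] l by auto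
  \<comment> \<open>No point of the disk hull lies on the line through the two centers. Beyond one
    of them it would contradict \<open>closer_than_beyond_center\<close>, with \<open>l\<close> in
    the opposite direction from that center; between them its distances to the centers would add up
    to \<open>norm d < 2 * R\<close>.\<close>
  have S0: "perp d \<bullet> (z - c) \<noteq> 0" if z: "z \<in> disk_hull R K" for z
  proof
    assume "perp d \<bullet> (z - c) = 0"
    then obtain \<kappa> where \<kappa>: "z - c = \<kappa> *\<^sub>R d"
      using perp_inner_eq_0_imp_scaleR[OF _ \<open>d \<noteq> 0\<close>] by blast
    then have z_eq: "z = c - (- \<kappa>) *\<^sub>R d" "z = c' - (\<kappa> - 1) *\<^sub>R (- d)"
      by (simp_all add: d_def algebra_simps)
    have dz: "R \<le> dist c z" "R \<le> dist c' z"
      using z c by (auto simp: disk_hull_def)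
    consider "\<kappa> < 0" | "1 < \<kappa>" | "0 \<le> \<kappa>" "\<kappa> \<le> 1"
      by linarith
    then show False
    proof cases
      case 1
      show False
        by (rule closer_than_beyond_center[of c "- \<kappa>" d p \<mu>])
          (use closer[OF z c(1)] l_closer[OF c(1)] 1 \<mu> in \<open>simp_all add: z_eq(1) l(1)\<close>)
    next
      case 2
      show False
        by (rule closer_than_beyond_center[of c' "\<kappa> - 1" "- d" p "1 - \<mu>"])
          (use closer[OF z c(2)] l_closer[OF c(2)] 2 \<mu> in
            \<open>simp_all add: z_eq(2) l(2) del: scaleR_minus_right scaleR_left_diff_distrib\<close>)
    next
      case 3
      have "dist c z = \<kappa> * norm d" "dist c' z = (1 - \<kappa>) * norm d"
      proof -
        have "c - z = - (\<kappa> *\<^sub>R d)" "c' - z = (1 - \<kappa>) *\<^sub>R d"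
          by (simp_all add: z_eq(1) d_def algebra_simps)
        then show "dist c z = \<kappa> * norm d" "dist c' z = (1 - \<kappa>) * norm d"
          using 3 by (simp_all add: dist_norm)
      qed
      then have "2 * R \<le> norm d"
        using dz by (simp add: algebra_simps)
      with c(3) show False
        by (simp add: d_def dist_norm norm_minus_commute)
    qed
  qed
  have Sl: "perp d \<bullet> (l - c) = 0"
    by (simp add: l)
  \<comment> \<open>The line through the centers crosses the chord in its interior, so a weighted
    mean of the signed offsets of the end points vanishes: they cannot both lie strictly on the same
    side.\<close>
  have comb: "(1 - \<nu>) * (perp d \<bullet> (x\<^sub>1 - c)) + \<nu> * (perp d \<bullet> (x\<^sub>2 - c)) = 0"
    using Sl by (simp add: l_def inner_simps algebra_simps)
  have K: "K \<subseteq> disk_hull R K"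
    by (rule disk_hull_superset)
  have side: False if sgn: "\<And>z. z \<in> K \<Longrightarrow> perp e \<bullet> (z - c) > 0" and e: "e = d \<or> e = - d" for e
  proof -
    have "K \<subseteq> {z. perp e \<bullet> z > perp e \<bullet> c}"
      using sgn by (auto simp: inner_diff_right)
    then have "convex hull K \<subseteq> {z. perp e \<bullet> z > perp e \<bullet> c}"
      by (intro hull_minimal convex_halfspace_gt)
    then have "perp e \<bullet> (x\<^sub>1 - c) > 0" "perp e \<bullet> (x\<^sub>2 - c) > 0"
      using hull x by (auto simp: inner_diff_right)
    then have "(1 - \<nu>) * (perp e \<bullet> (x\<^sub>1 - c)) + \<nu> * (perp e \<bullet> (x\<^sub>2 - c)) > 0"
      using \<nu> by (intro add_pos_pos mult_pos_pos) auto
    moreover have "perp (- d) = - perp d"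
      by (simp add: vec2_eq_iff)
    ultimately show False
      using comb e by (auto simp: algebra_simps)
  qed
  have "perp (- d) = - perp d"
    by (simp add: vec2_eq_iff)
  moreover have "(\<forall>z\<in>K. 0 < perp d \<bullet> (z - c)) \<or> (\<forall>z\<in>K. perp d \<bullet> (z - c) < 0)"
    using S0 K by (intro connected_nonzero_sign continuous_intros assms) blast
  ultimately show False
    using side[of d] side[of "- d"] by fastforce
qed

text \<open>Algebraic core of the next lemma, in coordinates in which the chord runs from \<open>(-h, 0)\<close> to
  \<open>(h, 0)\<close>: an \<open>R\<close>-disk missing both end points and centered above the chord does not reach the
  lowest point of the lens spanned by the chord.\<close>

lemma upper_disk_misses_lens_bottom:
  fixes h R c1 c2 :: real
  assumes "0 < h" "h < R" "0 \<le> c2"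
    and "R\<^sup>2 \<le> (c1 - h)\<^sup>2 + c2\<^sup>2" "R\<^sup>2 \<le> (c1 + h)\<^sup>2 + c2\<^sup>2"
  defines "\<sigma> \<equiv> R - sqrt (R\<^sup>2 - h\<^sup>2)"
  shows "R\<^sup>2 \<le> c1\<^sup>2 + (c2 + \<sigma>)\<^sup>2"
proof (rule ccontr)
  define \<kappa> where "\<kappa> = sqrt (R\<^sup>2 - h\<^sup>2)"
  have "h\<^sup>2 < R\<^sup>2"
    using assms by (intro power_strict_mono) auto
  then have \<kappa>: "0 < \<kappa>" "\<kappa>\<^sup>2 = R\<^sup>2 - h\<^sup>2"
    by (simp_all add: \<kappa>_def)
  then have "\<kappa>\<^sup>2 < R\<^sup>2"
    using \<open>0 < h\<close> by simp
  then have "\<kappa> < R"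
    using assms by (intro power2_less_imp_less[of \<kappa> R]) auto
  then have "0 < \<sigma>" and \<sigma>: "\<sigma> = R - \<kappa>"
    by (auto simp: \<sigma>_def \<kappa>_def)
  assume "\<not> ?thesis"
  then have less: "c1\<^sup>2 + (c2 + \<sigma>)\<^sup>2 < R\<^sup>2"
    by simp
  have a: "R\<^sup>2 \<le> (\<bar>c1\<bar> - h)\<^sup>2 + c2\<^sup>2"
    using assms(4,5) by (cases "0 \<le> c1") (auto simp: power2_eq_square algebra_simps)
  have "h\<^sup>2 - \<sigma>\<^sup>2 = 2 * \<kappa> * \<sigma>"
    using \<kappa>(2) by (simp add: \<sigma> power2_eq_square algebra_simps)
  moreover have sq: "(\<bar>c1\<bar> - h)\<^sup>2 = c1\<^sup>2 - 2 * h * \<bar>c1\<bar> + h\<^sup>2"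
    by (simp add: power2_diff)
  \<comment> \<open>Together with \<open>0 \<le> c2\<close> this yields \<open>c2 < \<kappa>\<close>
    and \<open>2 * \<bar>c1\<bar> \<le> h\<close>, which puts the nearer end point of the chord
    strictly inside the disk.\<close>
  ultimately have "2 * h * \<bar>c1\<bar> + 2 * \<sigma> * c2 < 2 * \<kappa> * \<sigma>"
    using a less by (simp add: power2_sum algebra_simps)
  moreover have "0 \<le> 2 * h * \<bar>c1\<bar>"
    using assms by simp
  ultimately have "\<sigma> * c2 < \<sigma> * \<kappa>"
    by (simp add: algebra_simps)
  then have "c2 < \<kappa>"
    using \<open>0 < \<sigma>\<close> by simp
  then have "c2\<^sup>2 < \<kappa>\<^sup>2"
    using assms by (intro power_strict_mono) auto
  moreover have "2 * \<kappa> * \<sigma> \<le> h\<^sup>2"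
    using \<open>h\<^sup>2 - \<sigma>\<^sup>2 = 2 * \<kappa> * \<sigma>\<close> zero_le_power2[of \<sigma>] by linarith
  then have "2 * h * \<bar>c1\<bar> \<le> h * h"
    using \<open>2 * h * \<bar>c1\<bar> + 2 * \<sigma> * c2 < 2 * \<kappa> * \<sigma>\<close> \<open>0 < \<sigma>\<close> \<open>0 \<le> c2\<close>
    by (simp add: power2_eq_square) (smt (verit) mult_nonneg_nonneg)
  then have "2 * \<bar>c1\<bar> \<le> h"
    using \<open>0 < h\<close> by (simp add: mult.commute mult.left_commute)
  then have "(\<bar>c1\<bar> - h)\<^sup>2 \<le> h\<^sup>2"
    by (intro iffD1[OF abs_le_square_iff]) auto
  ultimately show False
    using a \<kappa>(2) by simp
qed

text \<open>Two nearest points span a lens between the two \<open>R\<close>-disks with both points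
  on their boundary. The short axis of the lens lies closer to \<open>z\<close> than the hull does,
  so it is covered by \<open>R\<close>-disks missing \<open>K\<close>. A disk centered on one side
  of the chord misses the end of the axis on the other side; as the axis is connected, some point of
  it is covered from both sides. The segment joining these two centers crosses the chord, contrary
  to \<open>disk_hull_not_separated\<close>.\<close>

lemma disk_hull_unique_nearest:
  fixes K :: "(real^2) set"
  assumes K: "connected K" "compact K" "K \<subseteq> ball p R" "R > 0"
    and near: "nearest_point (disk_hull R K) z x\<^sub>1" "nearest_point (disk_hull R K) z x\<^sub>2"
    and zR: "dist z x\<^sub>1 < R"
  shows "x\<^sub>1 = x\<^sub>2"
proof (rule ccontr)
  assume "x\<^sub>1 \<noteq> x\<^sub>2"
  define m where "m = (1/2) *\<^sub>R (x\<^sub>1 + x\<^sub>2)"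
  define h where "h = norm (x\<^sub>2 - x\<^sub>1) / 2"
  define e where "e = sgn (x\<^sub>2 - x\<^sub>1)"
  define n where "n = perp e"
  define d where "d = dist z x\<^sub>1"
  have x: "x\<^sub>1 \<in> disk_hull R K" "x\<^sub>2 \<in> disk_hull R K"
    using near by (auto simp: nearest_point_def)
  have "h > 0" and ne: "norm e = 1"
    using \<open>x\<^sub>1 \<noteq> x\<^sub>2\<close> by (simp_all add: h_def e_def norm_sgn)
  have en: "e \<bullet> e = 1" "n \<bullet> n = 1" "e \<bullet> n = 0" "n \<bullet> e = 0"
    using ne by (simp_all add: n_def dot_square_norm)
  have xe: "x\<^sub>1 = m - h *\<^sub>R e" "x\<^sub>2 = m + h *\<^sub>R e"
    using \<open>x\<^sub>1 \<noteq> x\<^sub>2\<close>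
    by (simp_all add: m_def h_def e_def sgn_div_norm scaleR_right_diff_distrib scaleR_add_right
        flip: scaleR_left.add scaleR_left_distrib)
  have dsq: "(dist a b)\<^sup>2 = ((a - m) \<bullet> e - (b - m) \<bullet> e)\<^sup>2 + ((a - m) \<bullet> n - (b - m) \<bullet> n)\<^sup>2" for a b
    using frame_norm[OF ne, of "a - b"] by (simp add: dist_norm n_def inner_simps)
  have coord: "(x\<^sub>1 - m) \<bullet> e = - h" "(x\<^sub>1 - m) \<bullet> n = 0" "(x\<^sub>2 - m) \<bullet> e = h" "(x\<^sub>2 - m) \<bullet> n = 0"
    using en by (simp_all add: xe)
  define z1 z2 where "z1 = (z - m) \<bullet> e" and "z2 = (z - m) \<bullet> n"
  have d2: "d = dist z x\<^sub>2"
    using near by (simp add: d_def nearest_point_def order_antisym)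
  have "d\<^sup>2 = (z1 + h)\<^sup>2 + z2\<^sup>2" "d\<^sup>2 = (z1 - h)\<^sup>2 + z2\<^sup>2"
    using dsq[of z x\<^sub>1] dsq[of z x\<^sub>2] coord d2 by (simp_all add: d_def z1_def z2_def)
  then have "z1 = 0" and dz: "d\<^sup>2 = h\<^sup>2 + z2\<^sup>2"
    using \<open>h > 0\<close> by (auto simp: power2_eq_square algebra_simps)
  have "0 \<le> d" "d < R"
    using zR by (simp_all add: d_def)
  then have dR: "d\<^sup>2 < R\<^sup>2"
    by (intro power_strict_mono) auto
  have "h\<^sup>2 < R\<^sup>2"
    using dz dR zero_le_power2[of z2] by linarith
  then have "h < R"
    using \<open>R > 0\<close> by (intro power2_less_imp_less[of h R]) auto
  \<comment> \<open>\<open>\<kappa>\<close> is the distance from the chord to the centers of the two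
    \<open>R\<close>-circles through its end points, and \<open>\<sigma>\<close> is half the width
    of the lens between them.\<close>
  define \<kappa> where "\<kappa> = sqrt (R\<^sup>2 - h\<^sup>2)"
  have \<kappa>: "0 < \<kappa>" "\<kappa>\<^sup>2 = R\<^sup>2 - h\<^sup>2"
    using \<open>h\<^sup>2 < R\<^sup>2\<close> by (simp_all add: \<kappa>_def)
  define \<sigma> where "\<sigma> = R - \<kappa>"
  have "\<kappa>\<^sup>2 < R\<^sup>2"
    using \<kappa> \<open>h > 0\<close> by simp
  then have "\<kappa> < R"
    using \<open>R > 0\<close> by (intro power2_less_imp_less[of \<kappa> R]) auto
  then have "0 < \<sigma>"
    by (simp add: \<sigma>_def)
  \<comment> \<open>Both \<open>d^2 - z2^2\<close> and \<open>R^2 - \<kappa>^2\<close> equal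
    \<open>h^2\<close>; as \<open>d + \<bar>z2\<bar> < R + \<kappa>\<close>, the complementary
    factors satisfy \<open>R - \<kappa> < d - \<bar>z2\<bar>\<close>.\<close>
  have lens: "\<bar>z2\<bar> + \<sigma> < d"
  proof -
    have "\<bar>z2\<bar>\<^sup>2 < \<kappa>\<^sup>2"
      using dz dR \<kappa> by simp
    then have "\<bar>z2\<bar> < \<kappa>"
      using \<kappa> by (intro power2_less_imp_less[of "\<bar>z2\<bar>" \<kappa>]) auto
    have "(d - \<bar>z2\<bar>) * (d + \<bar>z2\<bar>) = (R - \<kappa>) * (R + \<kappa>)"
      using dz \<kappa>(2) by (simp add: power2_eq_square algebra_simps)
    moreover have "0 < (R - \<kappa>) * (R + \<kappa>)"
      using \<open>\<kappa> < R\<close> \<kappa> by simp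
    ultimately have "0 < (d - \<bar>z2\<bar>) * (d + \<bar>z2\<bar>)"
      by simp
    then have "0 < d - \<bar>z2\<bar>"
      using \<open>0 \<le> d\<close> by (auto simp: zero_less_mult_iff)
    have "(R - \<kappa>) * (R + \<kappa>) < (d - \<bar>z2\<bar>) * (R + \<kappa>)"
      using \<open>(d - \<bar>z2\<bar>) * (d + \<bar>z2\<bar>) = _\<close> \<open>0 < d - \<bar>z2\<bar>\<close> \<open>\<bar>z2\<bar> < \<kappa>\<close> \<open>d < R\<close>
      by (metis add_strict_mono mult_strict_left_mono)
    then have "R - \<kappa> < d - \<bar>z2\<bar>"
      using \<open>\<kappa> < R\<close> \<kappa> \<open>R > 0\<close> by (simp add: mult_less_cancel_right)
    then show ?thesis
      by (simp add: \<sigma>_def)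
  qed
  have out: "R\<^sup>2 \<le> ((c - m) \<bullet> e - h)\<^sup>2 + ((c - m) \<bullet> n)\<^sup>2" "R\<^sup>2 \<le> ((c - m) \<bullet> e + h)\<^sup>2 + ((c - m) \<bullet> n)\<^sup>2"
    if "c \<in> far_centers R K" for c
  proof -
    have "R \<le> dist c x\<^sub>1" "R \<le> dist c x\<^sub>2"
      using x that by (auto simp: disk_hull_def)
    then have "R\<^sup>2 \<le> (dist c x\<^sub>1)\<^sup>2" "R\<^sup>2 \<le> (dist c x\<^sub>2)\<^sup>2"
      using \<open>R > 0\<close> by (auto intro: power_mono)
    then show "R\<^sup>2 \<le> ((c - m) \<bullet> e - h)\<^sup>2 + ((c - m) \<bullet> n)\<^sup>2"
      "R\<^sup>2 \<le> ((c - m) \<bullet> e + h)\<^sup>2 + ((c - m) \<bullet> n)\<^sup>2"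
      using dsq[of c x\<^sub>1] dsq[of c x\<^sub>2] coord by simp_all
  qed
  define y where "y \<tau> = m + \<tau> *\<^sub>R n" for \<tau>
  have y_coord: "(y \<tau> - m) \<bullet> e = 0" "(y \<tau> - m) \<bullet> n = \<tau>" for \<tau>
    using en by (simp_all add: y_def)
  have dist_y: "(dist c (y \<tau>))\<^sup>2 = ((c - m) \<bullet> e)\<^sup>2 + ((c - m) \<bullet> n - \<tau>)\<^sup>2" for c \<tau>
    using dsq[of c "y \<tau>"] y_coord by simp
  \<comment> \<open>Parameters of the axis points covered from above the chord for
    \<open>s = 1\<close> and from below for \<open>s = -1\<close>; centers on the line of the chord
    count for both.\<close>
  define U where "U s = (\<Union>c\<in>{c\<in>far_centers R K. 0 \<le> s * ((c - m) \<bullet> n)}. y -` ball c R)" for s :: real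
  have "open (U s)" for s
    unfolding U_def y_def
    by (intro open_UN ballI open_vimage open_ball continuous_intros)
  have cover: "\<tau> \<in> U 1 \<union> U (-1)" if "\<tau> \<in> {-\<sigma>..\<sigma>}" for \<tau>
  proof -
    have "\<bar>z2 - \<tau>\<bar> < d"
      using that lens by (auto simp: abs_if split: if_splits)
    then have "(z2 - \<tau>)\<^sup>2 < d\<^sup>2"
      using \<open>0 \<le> d\<close> by (metis abs_of_nonneg abs_ge_zero power2_abs power_strict_mono pos2)
    then have "(dist z (y \<tau>))\<^sup>2 < d\<^sup>2"
      using \<open>z1 = 0\<close> by (simp add: dist_y flip: z1_def z2_def)
    then have "dist z (y \<tau>) < d"
      using \<open>0 \<le> d\<close> by (rule power2_less_imp_less)
    then have "y \<tau> \<notin> disk_hull R K"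
      using near by (auto simp: nearest_point_def d_def)
    then obtain c where "c \<in> far_centers R K" "dist c (y \<tau>) < R"
      by (auto simp: disk_hull_def)
    then show ?thesis
      by (cases "0 \<le> (c - m) \<bullet> n") (auto simp: U_def)
  qed
  have miss: "- (s * \<sigma>) \<notin> U s" if "s = 1 \<or> s = -1" for s
  proof
    assume "- (s * \<sigma>) \<in> U s"
    then obtain c where c: "c \<in> far_centers R K" "0 \<le> s * ((c - m) \<bullet> n)" "dist c (y (- (s * \<sigma>))) < R"
      by (auto simp: U_def)
    have "(dist c (y (- (s * \<sigma>))))\<^sup>2 < R\<^sup>2"
      using c(3) by (intro power_strict_mono) auto
    moreover have "R\<^sup>2 \<le> ((c - m) \<bullet> e)\<^sup>2 + (s * ((c - m) \<bullet> n) + (R - sqrt (R\<^sup>2 - h\<^sup>2)))\<^sup>2"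
      using out[OF c(1)] that
      by (intro upper_disk_misses_lens_bottom \<open>h > 0\<close> \<open>h < R\<close> c(2)) (auto simp: power_mult_distrib)
    moreover have "(s * ((c - m) \<bullet> n) + \<sigma>)\<^sup>2 = ((c - m) \<bullet> n + s * \<sigma>)\<^sup>2"
      using that by (auto simp: power2_eq_square algebra_simps)
    ultimately show False
      by (simp add: dist_y \<sigma>_def \<kappa>_def)
  qed
  have "\<exists>\<tau>. \<tau> \<in> U 1 \<inter> U (-1)"
  proof (rule ccontr)
    assume "\<nexists>\<tau>. \<tau> \<in> U 1 \<inter> U (-1)"
    then have "U 1 \<inter> U (-1) \<inter> {-\<sigma>..\<sigma>} = {}"
      by blast
    moreover have "\<sigma> \<in> U 1" "- \<sigma> \<in> U (-1)"
      using cover[of \<sigma>] cover[of "- \<sigma>"] miss[of 1] miss[of "-1"] \<open>0 < \<sigma>\<close> by auto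
    ultimately show False
      using connectedD[OF connected_Icc \<open>open (U 1)\<close> \<open>open (U (-1))\<close>, of "-\<sigma>" \<sigma>] cover \<open>0 < \<sigma>\<close>
      by fastforce
  qed
  then obtain \<tau> c c' where c: "c \<in> far_centers R K" "0 \<le> (c - m) \<bullet> n" "dist c (y \<tau>) < R"
    and c': "c' \<in> far_centers R K" "(c' - m) \<bullet> n \<le> 0" "dist c' (y \<tau>) < R"
    by (auto simp: U_def)
  define c1 c2 a w where "c1 = (c - m) \<bullet> e" and "c2 = (c - m) \<bullet> n"
    and "a = (c' - m) \<bullet> e" and "w = - ((c' - m) \<bullet> n)"
  have "0 \<le> c2" "0 \<le> w"
    using c(2) c'(2) by (simp_all add: c2_def w_def)
  have in1: "c1\<^sup>2 + (c2 - \<tau>)\<^sup>2 < R\<^sup>2" and in2: "a\<^sup>2 + (w + \<tau>)\<^sup>2 < R\<^sup>2"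
  proof -
    have "(dist c (y \<tau>))\<^sup>2 < R\<^sup>2" "(dist c' (y \<tau>))\<^sup>2 < R\<^sup>2"
      using c(3) c'(3) by (auto intro: power_strict_mono)
    moreover have "(c' - m) \<bullet> n - \<tau> = - (w + \<tau>)"
      by (simp add: w_def)
    ultimately show "c1\<^sup>2 + (c2 - \<tau>)\<^sup>2 < R\<^sup>2" "a\<^sup>2 + (w + \<tau>)\<^sup>2 < R\<^sup>2"
      unfolding dist_y by (simp_all only: c1_def c2_def a_def power2_minus)
  qed
  have out1: "R\<^sup>2 \<le> (\<bar>c1\<bar> - h)\<^sup>2 + c2\<^sup>2" and out2: "R\<^sup>2 \<le> (\<bar>a\<bar> - h)\<^sup>2 + w\<^sup>2"
    using out[OF c(1)] out[OF c'(1)]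
    by (auto simp: c1_def c2_def a_def w_def abs_if power2_eq_square algebra_simps)
  have e1: "2 * h * \<bar>c1\<bar> - 2 * \<tau> * c2 < h\<^sup>2 - \<tau>\<^sup>2"
    using in1 out1 by (simp add: power2_diff power2_abs algebra_simps)
  have e2: "2 * h * \<bar>a\<bar> + 2 * \<tau> * w < h\<^sup>2 - \<tau>\<^sup>2"
    using in2 out2 by (simp add: power2_diff power2_sum power2_abs algebra_simps)
  \<comment> \<open>A center on the line of the chord would be closer than \<open>R\<close> to one
    of its end points.\<close>
  have pos: "0 < v" if "0 \<le> v" "R\<^sup>2 \<le> (\<bar>u\<bar> - h)\<^sup>2 + v\<^sup>2" "2 * h * \<bar>u\<bar> - 2 * s * v < h\<^sup>2 - s\<^sup>2" for u v s :: real
  proof (rule ccontr)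
    assume "\<not> 0 < v"
    with that have "v = 0" by simp
    have "2 * h * \<bar>u\<bar> < h\<^sup>2"
      using that(3) zero_le_power2[of s] unfolding \<open>v = 0\<close> mult_zero_right by linarith
    then have "h * (2 * \<bar>u\<bar>) < h * h"
      by (simp add: power2_eq_square mult.assoc mult.left_commute)
    then have "2 * \<bar>u\<bar> < h"
      using \<open>h > 0\<close> by simp
    then have "(\<bar>u\<bar> - h)\<^sup>2 \<le> h\<^sup>2"
      by (intro iffD1[OF abs_le_square_iff]) auto
    with that \<open>v = 0\<close> \<open>h\<^sup>2 < R\<^sup>2\<close> show False
      by simp
  qed
  have "0 < c2" "0 < w"
    using pos[OF \<open>0 \<le> c2\<close> out1 e1] pos[OF \<open>0 \<le> w\<close> out2, of "- \<tau>"] e2 by simp_all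
  \<comment> \<open>The segment from \<open>c\<close> to \<open>c'\<close> meets the line of the
    chord at weight \<open>\<mu>\<close>, and \<open>l\<close> is the signed position of that point
    along \<open>e\<close>, measured from \<open>m\<close>.\<close>
  define \<mu> where "\<mu> = c2 / (c2 + w)"
  define l where "l = (w * c1 + c2 * a) / (c2 + w)"
  have "\<bar>l\<bar> < h"
  proof -
    \<comment> \<open>The weights \<open>w\<close> and \<open>c2\<close> cancel the terms that are
      linear in \<open>\<tau>\<close>.\<close>
    have "w * (2 * h * \<bar>c1\<bar> - 2 * \<tau> * c2) + c2 * (2 * h * \<bar>a\<bar> + 2 * \<tau> * w) < w * (h\<^sup>2 - \<tau>\<^sup>2) + c2 * (h\<^sup>2 - \<tau>\<^sup>2)"
      using \<open>0 < c2\<close> \<open>0 < w\<close> e1 e2 by (intro add_strict_mono mult_strict_left_mono)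
    then have "2 * h * (w * \<bar>c1\<bar> + c2 * \<bar>a\<bar>) < (c2 + w) * (h\<^sup>2 - \<tau>\<^sup>2)"
      by (simp add: algebra_simps)
    also have "\<dots> \<le> (c2 + w) * h\<^sup>2"
      using \<open>0 < c2\<close> \<open>0 < w\<close> by (intro mult_left_mono) auto
    finally have "h * (2 * (w * \<bar>c1\<bar> + c2 * \<bar>a\<bar>)) < h * (h * (c2 + w))"
      by (simp add: power2_eq_square algebra_simps)
    then have "2 * (w * \<bar>c1\<bar> + c2 * \<bar>a\<bar>) < h * (c2 + w)"
      using \<open>h > 0\<close> by simp
    moreover have "\<bar>w * c1 + c2 * a\<bar> \<le> w * \<bar>c1\<bar> + c2 * \<bar>a\<bar>"
      using \<open>0 < c2\<close> \<open>0 < w\<close> abs_triangle_ineq[of "w * c1" "c2 * a"] by (simp add: abs_mult)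
    moreover have "0 < h * (c2 + w)"
      using \<open>h > 0\<close> \<open>0 < c2\<close> \<open>0 < w\<close> by simp
    moreover have "X < Z" if "2 * Y < Z" "X \<le> Y" "0 < Z" for X Y Z :: real
      using that by linarith
    ultimately have "\<bar>w * c1 + c2 * a\<bar> < h * (c2 + w)"
      by blast
    then show ?thesis
      using \<open>0 < c2\<close> \<open>0 < w\<close> by (simp add: l_def abs_divide divide_less_eq)
  qed
  define \<nu> where "\<nu> = (h + l) / (2 * h)"
  have \<nu>: "0 < \<nu>" "\<nu> < 1"
    using \<open>\<bar>l\<bar> < h\<close> \<open>h > 0\<close> by (auto simp: \<nu>_def divide_less_eq)
  have \<mu>: "0 \<le> \<mu>" "\<mu> \<le> 1"
    using \<open>0 < c2\<close> \<open>0 < w\<close> by (auto simp: \<mu>_def)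
  have "dist c c' < 2 * R"
    using dist_triangle[of c c' "y \<tau>"] c(3) c'(3) by (simp add: dist_commute)
  moreover have "(1 - \<mu>) *\<^sub>R c + \<mu> *\<^sub>R c' = (1 - \<nu>) *\<^sub>R x\<^sub>1 + \<nu> *\<^sub>R x\<^sub>2"
  proof -
    have "c - m = c1 *\<^sub>R e + c2 *\<^sub>R n" "c' - m = a *\<^sub>R e - w *\<^sub>R n"
      using frame_expand[OF ne, of "c - m"] frame_expand[OF ne, of "c' - m"]
      by (simp_all add: c1_def c2_def a_def w_def n_def)
    then have cc: "c = m + c1 *\<^sub>R e + c2 *\<^sub>R n" "c' = m + a *\<^sub>R e - w *\<^sub>R n"
      by (simp_all add: algebra_simps)
    have "(1 - \<mu>) *\<^sub>R c + \<mu> *\<^sub>R c' = m + ((1 - \<mu>) * c1 + \<mu> * a) *\<^sub>R e + ((1 - \<mu>) * c2 - \<mu> * w) *\<^sub>R n"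
      unfolding cc by (simp add: algebra_simps)
    moreover have "1 - \<mu> = w / (c2 + w)"
      using \<open>0 < c2\<close> \<open>0 < w\<close> by (simp add: \<mu>_def field_simps)
    then have "(1 - \<mu>) * c2 - \<mu> * w = 0" "(1 - \<mu>) * c1 + \<mu> * a = l"
      by (simp_all add: \<mu>_def l_def add_divide_distrib)
    moreover have "(1 - \<nu>) *\<^sub>R x\<^sub>1 + \<nu> *\<^sub>R x\<^sub>2 = m + ((2 * \<nu> - 1) * h) *\<^sub>R e"
      unfolding xe by (simp add: vec2_eq_iff algebra_simps)
    moreover have "(2 * \<nu> - 1) * h = l"
      using \<open>h > 0\<close> by (simp add: \<nu>_def field_simps)
    ultimately show ?thesis
      by simp
  qed
  ultimately show False
    by (rule disk_hull_not_separated[OF K x c(1) c'(1) _ \<mu> \<nu>])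
qed

lemma is_R_hull_disk_hull:
  fixes K :: "(real^2) set"
  assumes "connected K" "compact K" "K \<subseteq> ball p R" "R > 0" "K \<noteq> {}"
  shows "is_R_hull R K (disk_hull R K)"
  unfolding is_R_hull_def
proof (intro conjI allI impI)
  show "closed (disk_hull R K)" "K \<subseteq> disk_hull R K"
    by (rule closed_disk_hull disk_hull_superset)+
  show "disk_hull R K \<subseteq> B" if "closed B \<and> K \<subseteq> B \<and> ereal R \<le> reach B" for B
    using that assms by (intro disk_hull_minimal) auto
  show "ereal R \<le> reach (disk_hull R K)"
    unfolding reach_def
  proof (rule INF_greatest)
    fix x assume x: "x \<in> disk_hull R K"
    have "\<exists>!y. nearest_point (disk_hull R K) z y" if "z \<in> ball x R" for z
    proof -
      obtain y where y: "nearest_point (disk_hull R K) z y"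
        using nearest_point_exists[OF closed_disk_hull] x by blast
      have "dist z y \<le> dist z x"
        using y x by (simp add: nearest_point_def)
      then have "dist z y < R"
        using that by (simp add: dist_commute)
      then show ?thesis
        using disk_hull_unique_nearest[OF assms(1-4) y] y by blast
    qed
    then show "ereal R \<le> reach_at (disk_hull R K) x"
      unfolding reach_at_def using \<open>R > 0\<close> by (intro Sup_upper) auto
  qed
qed

subsection \<open>Free directions\<close>

definition free_dirs :: "real \<Rightarrow> 'a::real_inner set \<Rightarrow> 'a \<Rightarrow> 'a set" where
  "free_dirs R K x = {u. norm u = 1 \<and> K \<inter> ball (x + R *\<^sub>R u) R = {}}"

lemma norm_diff_square:
  fixes v w :: "'a::real_inner"
  shows "(norm (v - w))\<^sup>2 = (norm v)\<^sup>2 - 2 * (v \<bullet> w) + (norm w)\<^sup>2"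
  unfolding power2_norm_eq_inner by (simp add: inner_simps inner_commute)

text \<open>Expanding the squared distance from \<open>y\<close> to the center turns avoidance of
  the disk into an inequality linear in \<open>u\<close>, which suits limits, persistence and the
  normal cone.\<close>

lemma free_dirs_iff:
  assumes "R > 0"
  shows "u \<in> free_dirs R K x \<longleftrightarrow>
    norm u = 1 \<and> (\<forall>y\<in>K. 2 * R * (u \<bullet> (y - x)) \<le> (norm (y - x))\<^sup>2)"
proof -
  have "y \<in> ball (x + R *\<^sub>R u) R \<longleftrightarrow> (norm (y - x))\<^sup>2 < 2 * R * (u \<bullet> (y - x))" if "norm u = 1" for y
  proof -
    have "y \<in> ball (x + R *\<^sub>R u) R \<longleftrightarrow> norm ((y - x) - R *\<^sub>R u) < R"
      by (simp add: dist_norm norm_minus_commute algebra_simps)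
    also have "\<dots> \<longleftrightarrow> (norm ((y - x) - R *\<^sub>R u))\<^sup>2 < R\<^sup>2"
      using assms by (metis less_imp_le norm_ge_zero power2_less_imp_less power_strict_mono pos2)
    also have "(norm ((y - x) - R *\<^sub>R u))\<^sup>2 = (norm (y - x))\<^sup>2 - 2 * R * (u \<bullet> (y - x)) + R\<^sup>2"
      unfolding norm_diff_square using that by (simp add: inner_commute power_mult_distrib)
    finally show ?thesis
      by auto
  qed
  then show ?thesis
    unfolding free_dirs_def disjoint_iff mem_Collect_eq by (meson linorder_not_less)
qed

text \<open>The part of the bisecting disk that the two old disks leave uncovered stays away from
  \<open>x\<close>, and the points of its circle there lie outside \<open>ball x R\<close>. As
  \<open>K\<close> is connected, contains \<open>x\<close> and lies in that ball, it cannot enter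
  this part.\<close>

lemma free_dirs_sgn_add:
  fixes K :: "(real^2) set"
  assumes "connected K" "x \<in> K" "K \<subseteq> ball x R" "R > 0"
    and u: "u\<^sub>1 \<in> free_dirs R K x" "u\<^sub>2 \<in> free_dirs R K x" and "u\<^sub>1 + u\<^sub>2 \<noteq> 0" "u\<^sub>1 \<noteq> u\<^sub>2"
  shows "sgn (u\<^sub>1 + u\<^sub>2) \<in> free_dirs R K x"
proof -
  define u where "u = sgn (u\<^sub>1 + u\<^sub>2)"
  define n where "n = perp u"
  \<comment> \<open>\<open>c\<close> and \<open>s\<close> are the cosine and the sine of half the
    angle between the two directions; \<open>p\<close> and \<open>q\<close> below measure
    \<open>y - x\<close> along the bisector and, in absolute value, across it.\<close>
  define c where "c = norm (u\<^sub>1 + u\<^sub>2) / 2"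
  define s where "s = \<bar>u\<^sub>1 \<bullet> n\<bar>"
  have nu: "norm u = 1"
    using assms by (simp add: u_def norm_sgn)
  have n12: "norm u\<^sub>1 = 1" "norm u\<^sub>2 = 1"
    using u by (simp_all add: free_dirs_def)
  have "c > 0"
    using assms by (simp add: c_def)
  have sum: "u\<^sub>1 + u\<^sub>2 = (2 * c) *\<^sub>R u"
    using assms by (simp add: c_def u_def sgn_div_norm)
  have inn: "u\<^sub>1 \<bullet> u\<^sub>1 = 1" "u\<^sub>2 \<bullet> u\<^sub>2 = 1" "u \<bullet> u = 1"
    using n12 nu by (simp_all add: dot_square_norm)
  have "(u\<^sub>1 + u\<^sub>2) \<bullet> (u\<^sub>1 - u\<^sub>2) = 0"
    using inn by (simp add: inner_simps inner_commute)
  then have "u \<bullet> u\<^sub>1 = u \<bullet> u\<^sub>2"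
    using \<open>c > 0\<close> by (simp add: sum inner_simps)
  moreover have "u \<bullet> (u\<^sub>1 + u\<^sub>2) = 2 * c"
    using inn by (simp add: sum)
  ultimately have uc: "u\<^sub>1 \<bullet> u = c" "u\<^sub>2 \<bullet> u = c"
    by (simp_all add: inner_simps inner_commute)
  have "n \<bullet> (u\<^sub>1 + u\<^sub>2) = 0"
    by (simp add: sum n_def)
  then have un: "u\<^sub>2 \<bullet> n = - (u\<^sub>1 \<bullet> n)"
    by (simp add: inner_simps inner_commute)
  have cs: "c\<^sup>2 + s\<^sup>2 = 1"
    using frame_norm[OF nu, of u\<^sub>1] n12 uc by (simp add: s_def n_def)
  have "s \<noteq> 0"
  proof
    assume "s = 0"
    then have "u\<^sub>1 = u\<^sub>2"
      using frame_expand[OF nu, of u\<^sub>1] frame_expand[OF nu, of u\<^sub>2] uc un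
      by (simp add: s_def n_def)
    with \<open>u\<^sub>1 \<noteq> u\<^sub>2\<close> show False by simp
  qed
  then have "s > 0"
    by (simp add: s_def)
  then have "0 < s\<^sup>2"
    by simp
  then have "c\<^sup>2 < 1"
    using cs by linarith
  then have "c\<^sup>2 < 1\<^sup>2"
    by simp
  then have "c < 1"
    by (rule power2_less_imp_less) simp
  define p q where "p y = (y - x) \<bullet> u" and "q y = \<bar>(y - x) \<bullet> n\<bar>" for y
  have nrm: "(norm (y - x))\<^sup>2 = (p y)\<^sup>2 + (q y)\<^sup>2" for y
    using frame_norm[OF nu, of "y - x"] by (simp add: p_def q_def n_def)
  have Kpq: "2 * R * (c * p y + s * q y) \<le> (norm (y - x))\<^sup>2" if "y \<in> K" for y
  proof -
    have "u\<^sub>1 \<bullet> (y - x) = c * p y + (u\<^sub>1 \<bullet> n) * ((y - x) \<bullet> n)"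
      "u\<^sub>2 \<bullet> (y - x) = c * p y - (u\<^sub>1 \<bullet> n) * ((y - x) \<bullet> n)"
      using frame_inner[OF nu, of u\<^sub>1 "y - x"] frame_inner[OF nu, of u\<^sub>2 "y - x"] uc un
      by (simp_all add: p_def n_def)
    moreover have "s * q y = \<bar>(u\<^sub>1 \<bullet> n) * ((y - x) \<bullet> n)\<bar>"
      by (simp add: s_def q_def abs_mult)
    ultimately have "c * p y + s * q y = u\<^sub>1 \<bullet> (y - x) \<or> c * p y + s * q y = u\<^sub>2 \<bullet> (y - x)"
      by (auto simp: abs_if)
    then show ?thesis
      using u that \<open>R > 0\<close> by (auto simp: free_dirs_iff)
  qed
  \<comment> \<open>A point of the closed new disk outside both old disks lies in a cone around the
    bisector, \<open>s * q y \<le> (1 - c) * p y\<close>; squaring and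
    \<open>s^2 = (1 - c) * (1 + c)\<close> give the bound.\<close>
  have aspect: "(1 + c) * (norm (y - x))\<^sup>2 \<le> 2 * (p y)\<^sup>2" "0 \<le> p y"
    if y: "y \<in> K" "(norm (y - x))\<^sup>2 \<le> 2 * R * p y" for y
  proof -
    have "2 * R * (c * p y + s * q y) \<le> 2 * R * p y"
      using Kpq[OF y(1)] y(2) by linarith
    then have "c * p y + s * q y \<le> p y"
      using \<open>R > 0\<close> by simp
    then have sq: "s * q y \<le> (1 - c) * p y"
      by (simp add: algebra_simps)
    have "0 \<le> s * q y"
      using \<open>s > 0\<close> by (simp add: q_def)
    then show "0 \<le> p y"
      using sq \<open>c < 1\<close> by (smt (verit) mult_pos_neg)
    have "(s * q y)\<^sup>2 \<le> ((1 - c) * p y)\<^sup>2"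
      using sq \<open>0 \<le> s * q y\<close> by (rule power_mono)
    moreover have "s\<^sup>2 = (1 - c) * (1 + c)"
      using cs by (simp add: power2_eq_square algebra_simps)
    ultimately have "(1 - c) * ((1 + c) * (q y)\<^sup>2) \<le> (1 - c) * ((1 - c) * (p y)\<^sup>2)"
      by (simp add: power_mult_distrib power2_eq_square[of "1 - c"] mult.assoc)
    then have "(1 + c) * (q y)\<^sup>2 \<le> (1 - c) * (p y)\<^sup>2"
      using \<open>c < 1\<close> by simp
    then show "(1 + c) * (norm (y - x))\<^sup>2 \<le> 2 * (p y)\<^sup>2"
      by (simp add: nrm algebra_simps)
  qed
  \<comment> \<open>Points in the new disk stay away from \<open>x\<close>, so they are separated from \<open>x\<close> within \<open>K\<close>.\<close>
  define A B where "A = {y. (norm (y - x))\<^sup>2 < 2 * R * p y}"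
    and "B = {y. 2 * R * p y < (norm (y - x))\<^sup>2} \<union> {y. p y < R * c * (1 + c)}"
  have "open A" "open B"
    unfolding A_def B_def p_def by (intro open_Un open_Collect_less continuous_intros)+
  have "A \<inter> K = {}"
  proof -
    have "x \<in> B \<inter> K"
      using \<open>x \<in> K\<close> \<open>R > 0\<close> \<open>c > 0\<close> by (simp add: B_def p_def)
    moreover have "A \<inter> B \<inter> K = {}"
    proof -
      have far: "R * c * (1 + c) \<le> p y" if y: "y \<in> A" "y \<in> K" for y
      proof -
        have le: "(norm (y - x))\<^sup>2 \<le> 2 * R * p y"
          using y by (simp add: A_def)
        have "0 < 2 * R * p y"
          using y(1) zero_le_power2[of "norm (y - x)"] unfolding A_def mem_Collect_eq by linarith
        then have "0 < p y"
          using \<open>R > 0\<close> by (simp add: zero_less_mult_iff)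
        have "2 * R * (c * p y) \<le> 2 * R * (c * p y + s * q y)"
          using \<open>R > 0\<close> \<open>s > 0\<close> by (simp add: q_def)
        also have "\<dots> \<le> (norm (y - x))\<^sup>2"
          by (rule Kpq[OF y(2)])
        finally have "(1 + c) * (2 * R * (c * p y)) \<le> (1 + c) * (norm (y - x))\<^sup>2"
          using \<open>c > 0\<close> by (intro mult_left_mono) auto
        also have "\<dots> \<le> 2 * (p y)\<^sup>2"
          by (rule aspect[OF y(2) le])
        finally have "p y * (R * c * (1 + c)) \<le> p y * p y"
          by (simp add: power2_eq_square algebra_simps)
        then show ?thesis
          using \<open>0 < p y\<close> by simp
      qed
      have "y \<notin> B" if y: "y \<in> A" "y \<in> K" for y
      proof
        assume "y \<in> B"
        then show False
          using far[OF y] y(1) unfolding A_def B_def Un_iff mem_Collect_eq by (elim disjE) linarith+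
      qed
      then show ?thesis
        by blast
    qed
    moreover have "K \<subseteq> A \<union> B"
    proof
      fix y assume y: "y \<in> K"
      show "y \<in> A \<union> B"
      proof (rule ccontr)
        assume "y \<notin> A \<union> B"
        \<comment> \<open>A point of \<open>K\<close> in neither set lies on the new circle away
          from \<open>x\<close>, where \<open>aspect\<close> forces
          \<open>(1 + c) * R \<le> p y\<close>, beyond the ball around \<open>x\<close>.\<close>
        then have eq: "(norm (y - x))\<^sup>2 = 2 * R * p y" and py: "R * c * (1 + c) \<le> p y"
          by (auto simp: A_def B_def)
        have "0 < R * c * (1 + c)"
          using \<open>R > 0\<close> \<open>c > 0\<close> by simp
        then have "0 < p y"
          using py by linarith
        have "(1 + c) * (2 * R * p y) \<le> 2 * (p y)\<^sup>2"
          using aspect(1)[OF y] eq by simp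
        then have "p y * ((1 + c) * R) \<le> p y * p y"
          by (simp add: power2_eq_square algebra_simps)
        then have "(1 + c) * R \<le> p y"
          using \<open>0 < p y\<close> by simp
        moreover have "p y \<le> norm (y - x)"
          using norm_cauchy_schwarz[of "y - x" u] nu by (simp add: p_def)
        moreover have "norm (y - x) < R"
          using y assms(3) by (auto simp: dist_norm norm_minus_commute)
        moreover have "R < (1 + c) * R"
          using \<open>R > 0\<close> \<open>c > 0\<close> by simp
        ultimately show False
          by linarith
      qed
    qed
    ultimately show ?thesis
      using connectedD[OF \<open>connected K\<close> \<open>open A\<close> \<open>open B\<close>] by blast
  qed
  then have "y \<notin> A" if "y \<in> K" for y
    using that by blast
  then have "2 * R * (u \<bullet> (y - x)) \<le> (norm (y - x))\<^sup>2" if "y \<in> K" for y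
    using that by (simp add: A_def p_def inner_commute not_less)
  then show ?thesis
    using nu \<open>R > 0\<close> by (simp add: free_dirs_iff flip: u_def)
qed

text \<open>The two opposite disks touch at \<open>x\<close> and cover all other points of their
  common axis within \<open>ball x R\<close>. So the connected set \<open>K - {x}\<close> stays
  strictly on one side of this axis, and the normal pointing to the other side is free.\<close>

lemma free_dirs_antipodal:
  fixes K :: "(real^2) set"
  assumes "connected (K - {x})" "K \<subseteq> ball x R" "R > 0"
    and u: "u \<in> free_dirs R K x" "- u \<in> free_dirs R K x"
  obtains n where "n \<in> free_dirs R K x" "n \<bullet> u = 0"
proof -
  have nu: "norm u = 1"
    using u by (simp add: free_dirs_def)
  have S0: "perp u \<bullet> (y - x) \<noteq> 0" if y: "y \<in> K - {x}" for y
  proof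
    assume "perp u \<bullet> (y - x) = 0"
    moreover have "u \<noteq> 0"
      using nu by auto
    ultimately obtain \<kappa> where \<kappa>: "y - x = \<kappa> *\<^sub>R u"
      using perp_inner_eq_0_imp_scaleR by blast
    have "norm (y - x) < R"
      using y assms(2) by (auto simp: dist_norm norm_minus_commute)
    then have "\<bar>\<kappa>\<bar> < R"
      using nu \<kappa> by simp
    have "y - x \<noteq> 0"
      using y by simp
    then have "\<kappa> \<noteq> 0"
      using \<kappa> by auto
    have "2 * R * \<kappa> \<le> \<kappa>\<^sup>2" "2 * R * (- \<kappa>) \<le> \<kappa>\<^sup>2"
    proof -
      have "2 * R * (u \<bullet> (y - x)) \<le> (norm (y - x))\<^sup>2" "2 * R * (- u \<bullet> (y - x)) \<le> (norm (y - x))\<^sup>2"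
        using u y \<open>R > 0\<close> unfolding free_dirs_iff[OF \<open>R > 0\<close>] by blast+
      then show "2 * R * \<kappa> \<le> \<kappa>\<^sup>2" "2 * R * (- \<kappa>) \<le> \<kappa>\<^sup>2"
        using nu unfolding \<kappa> by (simp_all add: dot_square_norm)
    qed
    then have "\<bar>\<kappa>\<bar> * (2 * R) \<le> \<bar>\<kappa>\<bar> * \<bar>\<kappa>\<bar>"
      by (cases "0 \<le> \<kappa>") (simp_all add: power2_eq_square mult_ac)
    then have "2 * R \<le> \<bar>\<kappa>\<bar>"
      using \<open>\<kappa> \<noteq> 0\<close> using mult_le_cancel_left_pos[of "\<bar>\<kappa>\<bar>" "2 * R" "\<bar>\<kappa>\<bar>"] by simp
    then show False
      using \<open>\<bar>\<kappa>\<bar> < R\<close> \<open>R > 0\<close> by linarith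
  qed
  have "(\<forall>y\<in>K - {x}. 0 < perp u \<bullet> (y - x)) \<or> (\<forall>y\<in>K - {x}. perp u \<bullet> (y - x) < 0)"
    using S0 by (intro connected_nonzero_sign continuous_intros assms)
  then obtain s :: real where s: "s = 1 \<or> s = -1" "\<And>y. y \<in> K - {x} \<Longrightarrow> s * (perp u \<bullet> (y - x)) < 0"
  proof
    assume "\<forall>y\<in>K - {x}. 0 < perp u \<bullet> (y - x)"
    then show ?thesis
      by (intro that[of "-1"]) simp_all
  next
    assume "\<forall>y\<in>K - {x}. perp u \<bullet> (y - x) < 0"
    then show ?thesis
      by (intro that[of 1]) simp_all
  qed
  have "2 * R * ((s *\<^sub>R perp u) \<bullet> (y - x)) \<le> (norm (y - x))\<^sup>2" if "y \<in> K" for y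
  proof -
    have "(s *\<^sub>R perp u) \<bullet> (y - x) \<le> 0"
      using s(2)[of y] that by (cases "y = x") (simp_all add: less_imp_le)
    then have "2 * R * ((s *\<^sub>R perp u) \<bullet> (y - x)) \<le> 0"
      using \<open>R > 0\<close> by (intro mult_nonneg_nonpos) simp_all
    then show ?thesis
      using zero_le_power2 order_trans by blast
  qed
  moreover have "norm (s *\<^sub>R perp u) = 1"
    using s(1) nu by auto
  ultimately have "s *\<^sub>R perp u \<in> free_dirs R K x"
    using \<open>R > 0\<close> by (simp add: free_dirs_iff)
  then show ?thesis
    by (rule that) simp
qed

text \<open>Every two directions have another one strictly between them, so that the closed set of free
  directions is connected.\<close>

lemma free_dirs_between:
  fixes K :: "(real^2) set"
  assumes K: "connected K" "connected (K - {x})" "x \<in> K" "K \<subseteq> ball x R" "R > 0"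
    and u: "p \<in> free_dirs R K x" "q \<in> free_dirs R K x" "p \<noteq> q"
  obtains n where "n \<in> free_dirs R K x" "dist p n < dist p q" "dist n q < dist p q"
proof -
  have 1: "norm p = 1" "norm q = 1"
    using u by (simp_all add: free_dirs_def)
  have dsq: "(dist v w)\<^sup>2 = 2 - 2 * (v \<bullet> w)" if "norm v = 1" "norm w = 1" for v w :: "real^2"
    using that by (simp add: dist_norm norm_diff_square)
  have less: "dist v w < dist p q" if "norm v = 1" "norm w = 1" "p \<bullet> q < v \<bullet> w" for v w :: "real^2"
    using that 1 by (intro power2_less_imp_less[of "dist v w" "dist p q"]) (simp_all add: dsq)
  show ?thesis
  proof (cases "p + q = 0")
    case True
    then have q: "q = - p"
      by (simp add: add_eq_0_iff)
    obtain n where n: "n \<in> free_dirs R K x" "n \<bullet> p = 0"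
      using free_dirs_antipodal[OF K(2,4,5) u(1)] u(2) q by auto
    then show ?thesis
      using 1 by (intro that[of n] less) (auto simp: q free_dirs_def inner_commute dot_square_norm)
  next
    case False
    define c where "c = norm (p + q) / 2"
    have c: "c > 0"
      using False by (simp add: c_def)
    have "(norm (p + q))\<^sup>2 = 2 + 2 * (p \<bullet> q)"
      using 1 using norm_diff_square[of p "- q"] by simp
    then have csq: "2 * c\<^sup>2 = 1 + p \<bullet> q"
      by (simp add: c_def power_divide)
    have "(dist p q)\<^sup>2 > 0"
      using u(3) by simp
    then have "p \<bullet> q < 1"
      using dsq[OF 1] by simp
    then have "c\<^sup>2 < 1\<^sup>2"
      using csq by simp
    then have "c < 1"
      by (rule power2_less_imp_less) simp
    \<comment> \<open>By the half-angle formula \<open>p \<bullet> q = 2 * c^2 - 1\<close>, this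
      product equals \<open>c - p \<bullet> q\<close>.\<close>
    then have "(1 - c) * (1 + 2 * c) > 0"
      using c by simp
    then have "p \<bullet> q < c"
      using csq by (simp add: power2_eq_square algebra_simps)
    moreover have "p \<bullet> sgn (p + q) = c" "sgn (p + q) \<bullet> q = c"
      using csq c 1 by (simp_all add: sgn_div_norm inner_simps dot_square_norm inner_commute c_def power2_eq_square field_simps)
    moreover have "norm (sgn (p + q)) = 1"
      using False by (simp add: norm_sgn)
    ultimately show ?thesis
      using 1 free_dirs_sgn_add[OF K(1,3,4,5) u(1,2) False u(3)]
      by (intro that[of "sgn (p + q)"] less) auto
  qed
qed

text \<open>If the disk of radius \<open>R\<close> centered at \<open>R u\<close> has \<open>z\<close> on its boundary, then moving the
  disk in a free direction \<open>w\<close> takes it away from \<open>z\<close>.\<close>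

lemma free_direction_recedes:
  fixes u w z :: "real^2"
  assumes "norm u = 1" "norm w = 1" "z \<noteq> 0" "norm z < R"
    and u: "2 * R * (u \<bullet> z) = (norm z)\<^sup>2" and w: "2 * R * (w \<bullet> z) \<le> (norm z)\<^sup>2" and uw: "u \<bullet> w > 0"
  shows "w \<bullet> z < R * (u \<bullet> w)"
proof (rule ccontr)
  define r where "r = norm z"
  have r: "0 < r" "r < R" "z \<bullet> z = r * r"
    using assms by (simp_all add: r_def dot_square_norm power2_eq_square)
  assume "\<not> ?thesis"
  then have le: "R * (u \<bullet> w) \<le> w \<bullet> z"
    by simp
  have "0 < R * (u \<bullet> w)"
    using uw r by simp
  then have "w \<bullet> z > 0"
    using le by linarith
  have "r\<^sup>2 < R * r"
    using r by (simp add: power2_eq_square)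
  have "2 * R * (u \<bullet> z) < R * r"
    using u \<open>r\<^sup>2 < R * r\<close> unfolding r_def by linarith
  then have "R * (2 * (u \<bullet> z)) < R * r"
    by (simp add: mult.assoc mult.left_commute)
  then have U: "2 * (u \<bullet> z) < r"
    using r by simp
  have "2 * R * (w \<bullet> z) < R * r"
    using w \<open>r\<^sup>2 < R * r\<close> unfolding r_def by linarith
  then have "R * (2 * (w \<bullet> z)) < R * r"
    by (simp add: mult.assoc mult.left_commute)
  then have W: "2 * (w \<bullet> z) < r"
    using r by simp
  have "0 < R * (2 * (u \<bullet> z))"
    using u r by (simp add: mult.assoc mult.left_commute flip: r_def)
  then have "u \<bullet> z > 0"
    using r by (simp add: zero_less_mult_iff)
  \<comment> \<open>Both \<open>u\<close> and \<open>w\<close> make angles between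
    \<open>pi / 3\<close> and \<open>pi / 2\<close> with \<open>z\<close>, so their components
    across \<open>z\<close> are large. Opposite signs of these would contradict
    \<open>u \<bullet> w > 0\<close>; equal signs give \<open>u \<bullet> w > 3/4\<close>, which is
    incompatible with \<open>w \<bullet> z < R / 2\<close>.\<close>
  define X Y where "X = u \<bullet> perp z" and "Y = w \<bullet> perp z"
  have eq: "(u \<bullet> w) * (r * r) = (u \<bullet> z) * (w \<bullet> z) + X * Y"
    using frame_inner_scaled[of u w z] r by (simp add: X_def Y_def)
  have X: "X * X = r * r - (u \<bullet> z) * (u \<bullet> z)" and Y: "Y * Y = r * r - (w \<bullet> z) * (w \<bullet> z)"
    using frame_inner_scaled[of u u z] frame_inner_scaled[of w w z] r assms(1,2)
    by (simp_all add: X_def Y_def dot_square_norm)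
  have sq: "4 * (s * t) < r * r" if "0 < s" "2 * s < r" "0 < t" "2 * t < r" for s t
    using mult_strict_mono[of "2 * s" r "2 * t" r] that r by simp
  have XY: "3/4 * (r * r) < X * X" "3/4 * (r * r) < Y * Y"
    using sq[OF \<open>u \<bullet> z > 0\<close> U \<open>u \<bullet> z > 0\<close> U] sq[OF \<open>w \<bullet> z > 0\<close> W \<open>w \<bullet> z > 0\<close> W] X Y by linarith+
  have "0 < r * r"
    using r by simp
  then have "(3/4 * (r * r)) * (3/4 * (r * r)) < (X * X) * (Y * Y)"
    using XY by (intro mult_strict_mono[OF XY]) linarith+
  then have "(3/4 * (r * r))\<^sup>2 < \<bar>X * Y\<bar>\<^sup>2"
    by (simp add: power2_eq_square mult_ac)
  then have big: "3/4 * (r * r) < \<bar>X * Y\<bar>"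
    by (rule power2_less_imp_less) simp
  have prod: "0 < (u \<bullet> z) * (w \<bullet> z)" "4 * ((u \<bullet> z) * (w \<bullet> z)) < r * r"
    using \<open>u \<bullet> z > 0\<close> \<open>w \<bullet> z > 0\<close> sq U W by simp_all
  have "0 < (u \<bullet> w) * (r * r)"
    using uw r by simp
  then have "3/4 * (r * r) < (u \<bullet> w) * (r * r)"
    using eq big prod by linarith
  then have "3/4 < u \<bullet> w"
    using r by (simp add: mult_less_cancel_right)
  then have "3/4 * R < R * (u \<bullet> w)"
    using r by (simp add: mult.commute)
  with le W r show False
    by linarith
qed

text \<open>Continuous induction: the last time \<open>s\<close> with \<open>f s \<ge> 0\<close>
  must be \<open>\<beta>\<close>, since otherwise later ones follow by continuity if
  \<open>f s > 0\<close> and by the hypothesis \<open>right\<close> if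
  \<open>f s = 0\<close>.\<close>

lemma nonneg_if_at_right_nonneg:
  fixes f :: "real \<Rightarrow> real"
  assumes cont: "continuous_on {\<alpha>..\<beta>} f" and "\<alpha> \<le> \<beta>" "0 \<le> f \<alpha>"
    and right: "\<And>s. \<alpha> \<le> s \<Longrightarrow> s < \<beta> \<Longrightarrow> f s = 0 \<Longrightarrow> \<forall>\<^sub>F s' in at_right s. 0 \<le> f s'"
  shows "0 \<le> f \<beta>"
proof (rule ccontr)
  assume neg: "\<not> 0 \<le> f \<beta>"
  define T where "T = {s \<in> {\<alpha>..\<beta>}. 0 \<le> f s}"
  have "closed T"
    unfolding T_def by (intro continuous_on_closed_Collect_le continuous_intros cont)
  moreover have "bounded T"
    by (rule bounded_subset[of "{\<alpha>..\<beta>}"]) (auto simp: T_def)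
  moreover have "\<alpha> \<in> T"
    using assms(2,3) by (simp add: T_def)
  ultimately obtain s where s: "s \<in> T" "\<And>s'. s' \<in> T \<Longrightarrow> s' \<le> s"
    using compact_attains_sup[of T] unfolding compact_eq_bounded_closed by blast
  have "s \<le> \<beta>" "\<alpha> \<le> s" "0 \<le> f s"
    using s(1) by (auto simp: T_def)
  moreover have "s \<noteq> \<beta>"
    using neg \<open>0 \<le> f s\<close> by auto
  ultimately have "s < \<beta>"
    by simp
  have "\<forall>\<^sub>F s' in at_right s. 0 \<le> f s'"
  proof (cases "f s = 0")
    case True
    then show ?thesis
      using right \<open>s < \<beta>\<close> \<open>\<alpha> \<le> s\<close> by blast
  next
    case False
    have "continuous_on {s..\<beta>} f"
      using cont by (rule continuous_on_subset) (use \<open>\<alpha> \<le> s\<close> in auto)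
    then have "(f \<longlongrightarrow> f s) (at_right s)"
      using \<open>s < \<beta>\<close> by (rule continuous_on_Icc_at_rightD)
    moreover have "0 < f s"
      using False \<open>0 \<le> f s\<close> by simp
    ultimately have "\<forall>\<^sub>F s' in at_right s. 0 < f s'"
      by (rule order_tendstoD)
    then show ?thesis
      by eventually_elim simp
  qed
  moreover have "\<forall>\<^sub>F s' in at_right s. s' \<in> {s<..<\<beta>}"
    using \<open>s < \<beta>\<close> by (rule eventually_at_right_real)
  ultimately have "\<forall>\<^sub>F s' in at_right s. 0 \<le> f s' \<and> s' \<in> {s<..<\<beta>}"
    by (rule eventually_conj)
  then obtain s' where "0 \<le> f s'" "s < s'" "s' < \<beta>"
    using eventually_happens'[OF trivial_limit_at_right_real] by auto
  then have "s' \<in> T"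
    using \<open>\<alpha> \<le> s\<close> unfolding T_def by auto
  then show False
    using s(2)[of s'] \<open>s < s'\<close> by auto
qed

subsection \<open>Free directions along an \<open>R\<close>-path\<close>

lemma unit_inner_perturb:
  fixes u u' v v' :: "'a::real_inner"
  assumes "norm u = 1" "norm v' = 1" "dist u' u < \<epsilon>" "dist v' v < \<epsilon>"
  shows "u \<bullet> v - 2 * \<epsilon> < u' \<bullet> v'"
proof -
  have eq: "u' \<bullet> v' = u \<bullet> v + (u' - u) \<bullet> v' + u \<bullet> (v' - v)"
    by (simp add: inner_simps)
  have "\<bar>(u' - u) \<bullet> v'\<bar> < \<epsilon>" "\<bar>u \<bullet> (v' - v)\<bar> < \<epsilon>"
    using Cauchy_Schwarz_ineq2[of "u' - u" v'] Cauchy_Schwarz_ineq2[of u "v' - v"] assms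
    by (simp_all add: dist_norm)
  then show ?thesis
    using eq by linarith
qed

lemma inner_sgn:
  fixes u v :: "'a::real_inner"
  shows "u \<bullet> sgn v = (u \<bullet> v) / norm v"
  by (simp add: sgn_div_norm divide_inverse mult.commute)

locale injective_R_path =
  fixes R a b :: real and g :: "real \<Rightarrow> real^2"
  assumes R_pos: "R > 0"
    and R_path: "R_path R a b g"
    and inj: "inj_on g {a..b}"
    and near: "t \<in> {a..b} \<Longrightarrow> g ` {a..t} \<subseteq> ball (g t) R"
begin

lemma continuous_on_path: "continuous_on {a..b} g"
  using R_path by (simp add: R_path_def)

lemma path_tendsto:
  assumes "\<sigma> \<longlonglongrightarrow> s" "\<And>k::nat. \<sigma> k \<in> {a..b}" "s \<in> {a..b}"
  shows "(\<lambda>k. g (\<sigma> k)) \<longlonglongrightarrow> g s"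
  using continuous_on_path assms by (intro continuous_on_tendsto_compose[of _ g]) auto

lemma path_eq_iff: "s \<in> {a..b} \<Longrightarrow> t \<in> {a..b} \<Longrightarrow> g s = g t \<longleftrightarrow> s = t"
  using inj by (auto dest: inj_onD)

abbreviation trace :: "real \<Rightarrow> (real^2) set" where
  "trace s \<equiv> g ` {a..s}"

abbreviation free :: "real \<Rightarrow> (real^2) set" where
  "free s \<equiv> free_dirs R (trace s) (g s)"

text \<open>By injectivity, removing the end point leaves the image of a half-open interval, which
  is still connected.\<close>

lemma trace_props:
  assumes "s \<in> {a..b}"
  shows "compact (trace s)" "connected (trace s)" "connected (trace s - {g s})"
    "g s \<in> trace s" "trace s \<subseteq> ball (g s) R"
proof -
  have cont: "continuous_on {a..s} g"
    using continuous_on_path by (rule continuous_on_subset) (use assms in auto)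
  then show "compact (trace s)" "connected (trace s)"
    by (auto intro: compact_continuous_image connected_continuous_image)
  have "trace s - {g s} = g ` {a..<s}"
    using assms by (force simp: path_eq_iff)
  moreover have "connected (g ` {a..<s})"
    using cont by (intro connected_continuous_image) (auto elim: continuous_on_subset)
  ultimately show "connected (trace s - {g s})"
    by simp
  show "g s \<in> trace s" "trace s \<subseteq> ball (g s) R"
    using assms near by auto
qed

lemma free_iff:
  "u \<in> free s \<longleftrightarrow> norm u = 1 \<and> (\<forall>\<sigma>\<in>{a..s}. 2 * R * (u \<bullet> (g \<sigma> - g s)) \<le> (norm (g \<sigma> - g s))\<^sup>2)"
  by (auto simp: free_dirs_iff[OF R_pos])

lemma free_norm: "u \<in> free s \<Longrightarrow> norm u = 1"
  by (simp add: free_dirs_def)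

text \<open>A time \<open>\<tau> < s\<close> eventually precedes \<open>\<sigma> k\<close>, so its
  constraint passes to the limit; the constraint for \<open>\<tau> = s\<close> is trivial.\<close>

lemma free_limit:
  assumes \<sigma>: "\<sigma> \<longlonglongrightarrow> s" "\<And>k::nat. \<sigma> k \<in> {a..b}" "s \<in> {a..b}"
    and u: "\<And>k. u k \<in> free (\<sigma> k)" "u \<longlonglongrightarrow> l"
  shows "l \<in> free s"
  unfolding free_iff
proof (intro conjI ballI)
  have "(\<lambda>k. norm (u k)) \<longlonglongrightarrow> norm l"
    by (intro tendsto_norm u)
  then show "norm l = 1"
    using free_norm[OF u(1)] by (simp add: LIMSEQ_const_iff)
  fix \<tau> assume \<tau>: "\<tau> \<in> {a..s}"
  show "2 * R * (l \<bullet> (g \<tau> - g s)) \<le> (norm (g \<tau> - g s))\<^sup>2"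
  proof (cases "\<tau> = s")
    case False
    then have "\<forall>\<^sub>F k in sequentially. \<tau> < \<sigma> k"
      using \<tau> \<sigma>(1) by (intro order_tendstoD) auto
    then have ev: "\<forall>\<^sub>F k in sequentially. 2 * R * (u k \<bullet> (g \<tau> - g (\<sigma> k))) \<le> (norm (g \<tau> - g (\<sigma> k)))\<^sup>2"
      using u(1) \<tau> by (auto elim!: eventually_mono simp: free_iff)
    show ?thesis
      by (rule tendsto_le[OF sequentially_bot _ _ ev])
        (intro tendsto_intros path_tendsto u \<sigma>)+
  qed simp
qed

lemma compact_free:
  assumes "s \<in> {a..b}"
  shows "compact (free s)"
proof -
  have "closed (free s)"
    unfolding closed_sequential_limits using free_limit[of "\<lambda>_. s"] assms by blast
  moreover have "bounded (free s)"
    by (rule bounded_subset[OF bounded_sphere[of 0 1]]) (auto simp: free_dirs_def)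
  ultimately show ?thesis
    by (simp add: compact_eq_bounded_closed)
qed

section \<open>Right tangents and the persistence of free directions\<close>

text \<open>Limits of unit secant directions, taken along parameters rather than points of the
  image, so that local arguments in time can use them directly.\<close>

definition right_tangents :: "real \<Rightarrow> (real^2) set" where
  "right_tangents s = {w. \<exists>\<sigma>::nat \<Rightarrow> real.
     (\<forall>k. \<sigma> k \<in> {s<..b}) \<and> \<sigma> \<longlonglongrightarrow> s \<and> (\<lambda>k. sgn (g (\<sigma> k) - g s)) \<longlonglongrightarrow> w}"

text \<open>A limit of unit secants is a unit vector in the tangent cone of the remaining arc, so
  the defining property of an \<open>R\<close>-path applies to it.\<close>

lemma right_tangents_subset_free:
  assumes s: "s \<in> {a..b}"
  shows "right_tangents s \<subseteq> free s"
proof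
  fix w assume "w \<in> right_tangents s"
  then obtain \<sigma> :: "nat \<Rightarrow> real" where \<sigma>: "\<And>k. \<sigma> k \<in> {s<..b}" "\<sigma> \<longlonglongrightarrow> s"
    and w: "(\<lambda>k. sgn (g (\<sigma> k) - g s)) \<longlonglongrightarrow> w"
    by (auto simp: right_tangents_def)
  have in_ab: "\<sigma> k \<in> {a..b}" and neq: "g (\<sigma> k) - g s \<noteq> 0" for k
    using \<sigma>(1)[of k] s path_eq_iff[of "\<sigma> k" s] by auto
  have "(\<lambda>k. norm (sgn (g (\<sigma> k) - g s))) \<longlonglongrightarrow> norm w"
    by (intro tendsto_norm w)
  then have nw: "norm w = 1"
    using neq by (simp add: norm_sgn LIMSEQ_const_iff)
  have "w \<in> tangent_cone (g ` {s..b}) (g s)"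
    unfolding tangent_cone_def
  proof (intro CollectI allI impI)
    fix \<epsilon> :: real assume "\<epsilon> > 0"
    have "\<forall>\<^sub>F k in sequentially. dist (g (\<sigma> k)) (g s) < \<epsilon>"
      using path_tendsto[OF \<sigma>(2) in_ab s] \<open>\<epsilon> > 0\<close> by (rule tendstoD)
    moreover have "\<forall>\<^sub>F k in sequentially. dist (sgn (g (\<sigma> k) - g s)) w < \<epsilon>"
      using w \<open>\<epsilon> > 0\<close> by (rule tendstoD)
    ultimately have "\<forall>\<^sub>F k in sequentially. dist (g (\<sigma> k)) (g s) < \<epsilon> \<and> dist (sgn (g (\<sigma> k) - g s)) w < \<epsilon>"
      by (rule eventually_conj)
    then obtain k where "dist (g (\<sigma> k)) (g s) < \<epsilon>" "dist (sgn (g (\<sigma> k) - g s)) w < \<epsilon>"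
      using eventually_happens'[OF sequentially_bot] by blast
    then show "\<exists>x\<in>g ` {s..b}. \<exists>r>0. norm (x - g s) < \<epsilon> \<and> norm (r *\<^sub>R (x - g s) - w) < \<epsilon>"
      using \<sigma>(1)[of k] neq[of k]
      by (intro bexI[of _ "g (\<sigma> k)"] exI[of _ "inverse (norm (g (\<sigma> k) - g s))"])
        (auto simp: dist_norm sgn_div_norm)
  qed
  then show "w \<in> free s"
    using R_path s nw by (auto simp: R_path_def free_dirs_def)
qed

text \<open>Compactness of the unit circle provides convergent secant directions along times where
  \<open>P\<close> holds. This turns the failure of a property just after \<open>s\<close> into a
  right tangent that witnesses it.\<close>

lemma frequently_right_tangent:
  assumes s: "s \<in> {a..<b}" and freq: "\<exists>\<^sub>F s' in at_right s. P s'"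
  shows "\<exists>(\<sigma> :: nat \<Rightarrow> real) w. (\<forall>k. \<sigma> k \<in> {s<..b} \<and> P (\<sigma> k)) \<and> \<sigma> \<longlonglongrightarrow> s \<and>
    (\<lambda>k. sgn (g (\<sigma> k) - g s)) \<longlonglongrightarrow> w \<and> w \<in> right_tangents s"
proof -
  have "\<exists>s'. s' \<in> {s<..b} \<and> s' < s + 1 / Suc k \<and> P s'" for k
  proof (rule ccontr)
    assume no: "\<not> ?thesis"
    have "\<forall>\<^sub>F s' in at_right s. s' \<in> {s<..<b}" "\<forall>\<^sub>F s' in at_right s. s' \<in> {s<..<s + 1 / Suc k}"
      using s by (intro eventually_at_right_real; simp)+
    then have "\<forall>\<^sub>F s' in at_right s. \<not> P s'"
      by eventually_elim (use no in auto)
    with freq show False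
      by (simp add: frequently_def)
  qed
  then obtain \<sigma> where \<sigma>: "\<And>k. \<sigma> k \<in> {s<..b}" "\<And>k. \<sigma> k < s + 1 / Suc k" "\<And>k. P (\<sigma> k)"
    by metis
  have lim: "\<sigma> \<longlonglongrightarrow> s"
  proof (rule tendsto_sandwich)
    show "\<forall>\<^sub>F k in sequentially. s \<le> \<sigma> k" "\<forall>\<^sub>F k in sequentially. \<sigma> k \<le> s + 1 / Suc k"
      using \<sigma>(1,2) by (auto intro!: always_eventually less_imp_le)
    have "(\<lambda>k. s + inverse (real (Suc k))) \<longlonglongrightarrow> s + 0"
      by (intro tendsto_add tendsto_const LIMSEQ_inverse_real_of_nat)
    then show "(\<lambda>k. s + 1 / Suc k) \<longlonglongrightarrow> s"
      by (simp add: inverse_eq_divide)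
  qed simp
  have "sgn (g (\<sigma> k) - g s) \<in> sphere 0 1" for k
    using \<sigma>(1)[of k] s path_eq_iff[of "\<sigma> k" s] by (auto simp: norm_sgn)
  then obtain w r where r: "strict_mono r" "((\<lambda>k. sgn (g (\<sigma> k) - g s)) \<circ> r) \<longlonglongrightarrow> w"
    using compact_sphere[of "0::real^2" 1] unfolding compact_def by metis
  have "(\<lambda>k. \<sigma> (r k)) \<longlonglongrightarrow> s"
    using LIMSEQ_subseq_LIMSEQ[OF lim r(1)] by (simp add: o_def)
  moreover have "(\<lambda>k. sgn (g (\<sigma> (r k)) - g s)) \<longlonglongrightarrow> w"
    using r(2) by (simp add: o_def)
  moreover from calculation have "w \<in> right_tangents s"
    unfolding right_tangents_def
    using \<sigma>(1) by (intro CollectI exI[of _ "\<lambda>k. \<sigma> (r k)"] conjI allI) simp_all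
  ultimately show ?thesis
    using \<sigma>(1,3) by (intro exI[of _ "\<lambda>k. \<sigma> (r k)"] exI[of _ w] conjI allI)
qed

lemma right_tangents_nonempty:
  assumes "s \<in> {a..<b}"
  shows "right_tangents s \<noteq> {}"
  using frequently_right_tangent[OF assms, of "\<lambda>_. True"] by auto

text \<open>A mean value inequality without differentiability: if \<open>f\<close> became negative
  immediately after a zero \<open>s\<close>, the secants from \<open>g s\<close> would accumulate at
  a right tangent \<open>w\<close> with \<open>u \<bullet> w \<le> c\<close>.\<close>

lemma secant_inner_ge:
  assumes ab: "a \<le> \<alpha>" "\<alpha> \<le> \<beta>" "\<beta> \<le> b" and "0 \<le> c"
    and tan: "\<And>s w. s \<in> {\<alpha>..<\<beta>} \<Longrightarrow> w \<in> right_tangents s \<Longrightarrow> c < u \<bullet> w"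
  shows "c * norm (g \<beta> - g \<alpha>) \<le> u \<bullet> (g \<beta> - g \<alpha>)"
proof -
  define f where "f s = u \<bullet> (g s - g \<alpha>) - c * norm (g s - g \<alpha>)" for s
  have "0 \<le> f \<beta>"
  proof (rule nonneg_if_at_right_nonneg[of \<alpha> \<beta> f])
    have "continuous_on {\<alpha>..\<beta>} g"
      using continuous_on_path by (rule continuous_on_subset) (use ab in auto)
    then show "continuous_on {\<alpha>..\<beta>} f"
      unfolding f_def by (intro continuous_intros)
    show "0 \<le> f \<alpha>"
      by (simp add: f_def)
    fix s assume s: "\<alpha> \<le> s" "s < \<beta>" "f s = 0"
    show "\<forall>\<^sub>F s' in at_right s. 0 \<le> f s'"
    proof (rule ccontr)
      assume "\<not> ?thesis"
      then have freq: "\<exists>\<^sub>F s' in at_right s. f s' < 0"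
        by (simp add: frequently_def not_less)
      have "s \<in> {a..<b}"
        using ab s(1,2) by auto
      from frequently_right_tangent[OF this freq]
      obtain \<sigma> :: "nat \<Rightarrow> real" and w where \<sigma>: "\<And>k. \<sigma> k \<in> {s<..b}" "\<And>k. f (\<sigma> k) < 0"
        and w: "(\<lambda>k. sgn (g (\<sigma> k) - g s)) \<longlonglongrightarrow> w" "w \<in> right_tangents s"
        by auto
      have "u \<bullet> sgn (g (\<sigma> k) - g s) \<le> c" for k
      proof -
        define \<Delta> where "\<Delta> = g (\<sigma> k) - g s"
        have "\<Delta> \<noteq> 0"
          using \<sigma>(1)[of k] s(1,2) ab path_eq_iff[of "\<sigma> k" s] by (auto simp: \<Delta>_def)
        have "norm (g (\<sigma> k) - g \<alpha>) \<le> norm \<Delta> + norm (g s - g \<alpha>)"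
          using norm_triangle_ineq[of \<Delta> "g s - g \<alpha>"] by (simp add: \<Delta>_def)
        then have "c * norm (g (\<sigma> k) - g \<alpha>) \<le> c * (norm \<Delta> + norm (g s - g \<alpha>))"
          using \<open>0 \<le> c\<close> by (rule mult_left_mono)
        moreover have "u \<bullet> (g (\<sigma> k) - g \<alpha>) = u \<bullet> \<Delta> + u \<bullet> (g s - g \<alpha>)"
          by (simp add: \<Delta>_def inner_simps)
        ultimately have "u \<bullet> \<Delta> \<le> c * norm \<Delta>"
          using \<sigma>(2)[of k] s(3) unfolding f_def distrib_left by linarith
        then show ?thesis
          using \<open>\<Delta> \<noteq> 0\<close> unfolding \<Delta>_def[symmetric] inner_sgn by (simp add: pos_divide_le_eq)
      qed
      then have "u \<bullet> w \<le> c"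
        by (intro tendsto_upperbound[OF tendsto_inner[OF tendsto_const w(1)]]) auto
      moreover have "c < u \<bullet> w"
        using s by (intro tan[OF _ w(2)]) auto
      ultimately show False
        by simp
    qed
  qed fact
  then show ?thesis
    by (simp add: f_def)
qed

text \<open>For a fixed earlier point \<open>y\<close> of the curve, \<open>\<bar>y - g s\<bar>\<^sup>2 - 2 R (u \<bullet> (y - g s))\<close> stays
  nonnegative, because it cannot decrease where it vanishes.\<close>

lemma free_persists:
  assumes ab: "a \<le> \<alpha>" "\<alpha> \<le> \<beta>" "\<beta> \<le> b" and u: "u \<in> free \<alpha>"
    and tan: "\<And>s w. s \<in> {\<alpha>..<\<beta>} \<Longrightarrow> w \<in> right_tangents s \<Longrightarrow> 0 < u \<bullet> w"
  shows "u \<in> free \<beta>"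
  unfolding free_iff
proof (intro conjI ballI)
  show nu: "norm u = 1"
    using u by (rule free_norm)
  fix \<tau> assume \<tau>: "\<tau> \<in> {a..\<beta>}"
  show "2 * R * (u \<bullet> (g \<tau> - g \<beta>)) \<le> (norm (g \<tau> - g \<beta>))\<^sup>2"
  proof (cases "\<alpha> \<le> \<tau>")
    case True
    have "0 * norm (g \<beta> - g \<tau>) \<le> u \<bullet> (g \<beta> - g \<tau>)"
      using True \<tau> ab by (intro secant_inner_ge tan) auto
    then have "u \<bullet> (g \<tau> - g \<beta>) \<le> 0"
      by (simp add: inner_simps)
    then have "2 * R * (u \<bullet> (g \<tau> - g \<beta>)) \<le> 0"
      using R_pos by (intro mult_nonneg_nonpos) auto
    then show ?thesis
      using zero_le_power2 order_trans by blast
  next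
    case False
    define y where "y = g \<tau>"
    define f where "f s = (norm (y - g s))\<^sup>2 - 2 * R * (u \<bullet> (y - g s))" for s
    have "0 \<le> f \<beta>"
    proof (rule nonneg_if_at_right_nonneg[of \<alpha> \<beta> f])
      have "continuous_on {\<alpha>..\<beta>} g"
        using continuous_on_path by (rule continuous_on_subset) (use ab in auto)
      then show "continuous_on {\<alpha>..\<beta>} f"
        unfolding f_def by (intro continuous_intros)
      show "0 \<le> f \<alpha>"
        using u \<tau> False by (simp add: f_def y_def free_iff)
      fix s assume s: "\<alpha> \<le> s" "s < \<beta>" "f s = 0"
      have s_ab: "s \<in> {a..b}"
        using s ab by auto
      define z where "z = y - g s"
      have "z \<noteq> 0"
        using path_eq_iff[of \<tau> s] \<tau> False s ab by (auto simp: z_def y_def)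
      have "y \<in> trace s"
        using \<tau> False s by (auto simp: y_def)
      then have "y \<in> ball (g s) R"
        using trace_props(5)[OF s_ab] by blast
      then have "norm z < R"
        by (simp add: z_def dist_norm norm_minus_commute)
      show "\<forall>\<^sub>F s' in at_right s. 0 \<le> f s'"
      proof (rule ccontr)
        assume "\<not> ?thesis"
        then have freq: "\<exists>\<^sub>F s' in at_right s. f s' < 0"
          by (simp add: frequently_def not_less)
        have "s \<in> {a..<b}"
          using ab s by auto
        from frequently_right_tangent[OF this freq]
        obtain \<sigma> :: "nat \<Rightarrow> real" and w where \<sigma>: "\<And>k. \<sigma> k \<in> {s<..b}" "\<And>k. f (\<sigma> k) < 0"
          and w: "(\<lambda>k. sgn (g (\<sigma> k) - g s)) \<longlonglongrightarrow> w" "w \<in> right_tangents s"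
          by auto
        have in_ab: "\<sigma> k \<in> {a..b}" for k
          using \<sigma>(1)[of k] s_ab by auto
        define d where "d k = sgn (g (\<sigma> k) - g s)" for k
        \<comment> \<open>Comparing \<open>f (\<sigma> k) < 0\<close> with \<open>f s = 0\<close>
          and dividing by the length of the secant gives a bound whose limit contradicts
          \<open>free_direction_recedes\<close>.\<close>
        have "R * (u \<bullet> d k) \<le> d k \<bullet> z" for k
        proof -
          define \<Delta> where "\<Delta> = g (\<sigma> k) - g s"
          have "\<Delta> \<noteq> 0"
            using \<sigma>(1)[of k] s_ab in_ab path_eq_iff[of "\<sigma> k" s] by (auto simp: \<Delta>_def)
          have "y - g (\<sigma> k) = z - \<Delta>"
            by (simp add: z_def \<Delta>_def)
          then have "(norm (z - \<Delta>))\<^sup>2 - 2 * R * (u \<bullet> (z - \<Delta>)) < (norm z)\<^sup>2 - 2 * R * (u \<bullet> z)"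
            using \<sigma>(2)[of k] s(3) unfolding f_def z_def[symmetric] by simp
          then have "(norm \<Delta>)\<^sup>2 + 2 * (R * (u \<bullet> \<Delta>)) < 2 * (z \<bullet> \<Delta>)"
            unfolding norm_diff_square inner_diff_right right_diff_distrib by simp
          then have "R * (u \<bullet> \<Delta>) \<le> \<Delta> \<bullet> z"
            using zero_le_power2[of "norm \<Delta>"] unfolding inner_commute[of z] by linarith
          then show ?thesis
            unfolding d_def \<Delta>_def[symmetric] inner_sgn inner_commute[of _ z]
            using divide_right_mono[of "R * (u \<bullet> \<Delta>)" "\<Delta> \<bullet> z" "norm \<Delta>"] by (simp add: inner_commute)
        qed
        moreover have "(\<lambda>k. R * (u \<bullet> d k)) \<longlonglongrightarrow> R * (u \<bullet> w)" "(\<lambda>k. d k \<bullet> z) \<longlonglongrightarrow> w \<bullet> z"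
          unfolding d_def by (intro tendsto_intros w)+
        ultimately have "R * (u \<bullet> w) \<le> w \<bullet> z"
          by (intro LIMSEQ_le) auto
        moreover have "w \<bullet> z < R * (u \<bullet> w)"
        proof (rule free_direction_recedes[OF nu _ \<open>z \<noteq> 0\<close> \<open>norm z < R\<close>])
          have "w \<in> free s"
            using right_tangents_subset_free[OF s_ab] w(2) by blast
          then show "norm w = 1" "2 * R * (w \<bullet> z) \<le> (norm z)\<^sup>2"
            using \<tau> False s by (auto simp: free_iff z_def y_def)
          show "2 * R * (u \<bullet> z) = (norm z)\<^sup>2"
            using s(3) by (simp add: f_def z_def)
          show "0 < u \<bullet> w"
            using tan w(2) s by simp
        qed
        ultimately show False
          by simp
      qed
    qed fact
    then show ?thesis
      by (simp add: f_def y_def)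
  qed
qed

text \<open>If all free directions at time \<open>t\<close> made acute angles, then going back in time from \<open>t\<close> the
  sets of free directions could not become larger: they are connected, and by the previous lemma
  no direction near \<open>free t\<close> can get lost. But initially all directions are free.\<close>

lemma free_not_acute:
  assumes t: "t \<in> {a..b}"
  shows "\<exists>u\<in>free t. \<exists>v\<in>free t. u \<bullet> v \<le> 0"
proof (rule ccontr)
  assume "\<not> ?thesis"
  then have acute: "0 < u \<bullet> v" if "u \<in> free t" "v \<in> free t" for u v
    using that by (auto simp: not_le)
  \<comment> \<open>Compactness makes the acute angles uniform; if there are no free directions at
    all, any positive \<open>m\<close> serves.\<close>
  obtain m where "m > 0" and m: "\<And>u v. u \<in> free t \<Longrightarrow> v \<in> free t \<Longrightarrow> m \<le> u \<bullet> v"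
  proof (cases "free t = {}")
    case True
    then show ?thesis
      using that[of 1] by simp
  next
    case False
    have comp: "compact (free t \<times> free t)"
      using compact_free[OF t] by (intro compact_Times)
    have ne: "free t \<times> free t \<noteq> {}"
      using False by blast
    have "continuous_on (free t \<times> free t) (\<lambda>p. fst p \<bullet> snd p)"
      by (intro continuous_intros)
    from continuous_attains_inf[OF comp ne this]
    obtain p where "p \<in> free t \<times> free t" "\<forall>p'\<in>free t \<times> free t. fst p \<bullet> snd p \<le> fst p' \<bullet> snd p'"
      by blast
    then show ?thesis
      using acute by (intro that[of "fst p \<bullet> snd p"]) auto
  qed
  \<comment> \<open>Moving each of two vectors by less than \<open>m / 4\<close> costs less than
    \<open>m / 2\<close> of their inner product when the lengths are controlled, so unit vectors in
    \<open>U\<close> still make uniformly acute angles.\<close>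
  define U where "U = (\<Union>v\<in>free t. ball v (m / 4))"
  have "open U"
    by (auto simp: U_def)
  have free_U: "free t \<subseteq> U"
    using \<open>m > 0\<close> by (force simp: U_def)
  have U_inner: "m / 2 < u \<bullet> v" if uv: "u \<in> U" "v \<in> U" and "norm v = 1" for u v
  proof -
    obtain u' v' where "u' \<in> free t" "v' \<in> free t" "dist u u' < m / 4" "dist v v' < m / 4"
      using uv by (auto simp: U_def dist_commute)
    then show ?thesis
      using unit_inner_perturb[of u' v u "m / 4" v'] m[of u' v'] \<open>norm v = 1\<close> free_norm by fastforce
  qed
  have tan_U: "m / 2 < u \<bullet> w"
    if "u \<in> U" "w \<in> right_tangents s" "s \<in> {a..b}" "free s \<subseteq> U" for u w s
    using that right_tangents_subset_free[OF that(3)] by (intro U_inner) (auto intro: free_norm)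
  \<comment> \<open>The times from which on, up to \<open>t\<close>, no free direction leaves
    \<open>U\<close>. The infimum \<open>t0\<close> is shown to have this property too, and then
    both \<open>t0 = a\<close> and \<open>a < t0\<close> are impossible.\<close>
  define A where "A = {s \<in> {a..t}. \<forall>s'\<in>{s..t}. free s' \<subseteq> U}"
  have "t \<in> A"
    using t free_U by (simp add: A_def)
  have bdd: "bdd_below A"
    by (rule bdd_belowI[of _ a]) (simp add: A_def)
  define t0 where "t0 = Inf A"
  have t0: "a \<le> t0" "t0 \<le> t"
  proof -
    show "t0 \<le> t"
      unfolding t0_def using \<open>t \<in> A\<close> bdd by (rule cInf_lower)
    have "a \<le> s" if "s \<in> A" for s
      using that by (simp add: A_def)
    then show "a \<le> t0"
      unfolding t0_def using \<open>t \<in> A\<close> by (intro cInf_greatest) auto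
  qed
  then have t0_ab: "t0 \<in> {a..b}"
    using t by auto
  have after: "free s \<subseteq> U" if "t0 < s" "s \<le> t" for s
  proof -
    obtain s'' where "s'' \<in> A" "s'' < s"
      using \<open>t0 < s\<close> \<open>t \<in> A\<close> cInf_lessD[of A s] by (auto simp: t0_def)
    then show ?thesis
      using that by (auto simp: A_def)
  qed
  have after_t: "free s \<subseteq> free t" if s: "t0 < s" "s \<le> t" for s
  proof
    fix u assume u: "u \<in> free s"
    show "u \<in> free t"
    proof (rule free_persists[OF _ s(2) _ u])
      show "a \<le> s" "t \<le> b"
        using s t0 t by auto
      fix s' w assume s': "s' \<in> {s..<t}" and w: "w \<in> right_tangents s'"
      have "m / 2 < u \<bullet> w"
        using u after[OF s] s s' t t0 by (intro tan_U[OF _ w] after) auto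
      then show "0 < u \<bullet> w"
        using \<open>m > 0\<close> by simp
    qed
  qed
  have "free t0 \<subseteq> U"
  proof (cases "t0 = t")
    case True
    then show ?thesis
      using free_U by simp
  next
    case False
    then have "t0 < t"
      using t0 by simp
    \<comment> \<open>The tangents at \<open>t0\<close> are not yet known to lie in
      \<open>U\<close>, so the secant bound is obtained from starting times \<open>s'\<close>
      decreasing to \<open>t0\<close>.\<close>
    have secant: "m / 2 * norm (g s - g t0) \<le> u \<bullet> (g s - g t0)" if u: "u \<in> U" and s: "t0 < s" "s \<le> t" for u s
    proof (rule tendsto_le)
      have "continuous_on {t0..t} g"
        using continuous_on_path by (rule continuous_on_subset) (use t0 t in auto)
      then have lim: "(g \<longlongrightarrow> g t0) (at_right t0)"
        using \<open>t0 < t\<close> by (rule continuous_on_Icc_at_rightD)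
      show "((\<lambda>s'. u \<bullet> (g s - g s')) \<longlongrightarrow> u \<bullet> (g s - g t0)) (at_right t0)"
        "((\<lambda>s'. m / 2 * norm (g s - g s')) \<longlongrightarrow> m / 2 * norm (g s - g t0)) (at_right t0)"
        by (intro tendsto_intros lim)+
      show "\<forall>\<^sub>F s' in at_right t0. m / 2 * norm (g s - g s') \<le> u \<bullet> (g s - g s')"
        using eventually_at_right_real[OF s(1)]
      proof eventually_elim
        case (elim s')
        show ?case
        proof (rule secant_inner_ge)
          fix r w assume r: "r \<in> {s'..<s}" and w: "w \<in> right_tangents r"
          show "m / 2 < u \<bullet> w"
            using r elim s t0 t by (intro tan_U[OF u w] after) auto
        qed (use elim s t0 t \<open>m > 0\<close> in auto)
      qed
    qed simp
    \<comment> \<open>The limit of the secant bound controls the tangents at \<open>t0\<close> as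
      well, so a direction of \<open>U\<close> that is free at \<open>t0\<close> stays free until
      \<open>t\<close>.\<close>
    have near_t: "u \<in> free t" if u: "u \<in> free t0" "u \<in> U" for u
    proof (rule free_persists[OF t0 _ u(1)])
      show "t \<le> b"
        using t by simp
      fix s w assume s: "s \<in> {t0..<t}" and w: "w \<in> right_tangents s"
      have "m / 2 \<le> u \<bullet> w"
      proof (cases "s = t0")
        case False
        then show ?thesis
          using s t0 t by (intro less_imp_le[OF tan_U[OF u(2) w]] after) auto
      next
        case True
        obtain \<sigma> :: "nat \<Rightarrow> real" where \<sigma>: "\<And>k. \<sigma> k \<in> {t0<..b}" "\<sigma> \<longlonglongrightarrow> t0"
          and lim: "(\<lambda>k. sgn (g (\<sigma> k) - g t0)) \<longlonglongrightarrow> w"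
          using w unfolding True right_tangents_def by blast
        have "\<forall>\<^sub>F k in sequentially. \<sigma> k < t"
          using \<sigma>(2) \<open>t0 < t\<close> by (rule order_tendstoD)
        then have "\<forall>\<^sub>F k in sequentially. m / 2 \<le> u \<bullet> sgn (g (\<sigma> k) - g t0)"
        proof eventually_elim
          case (elim k)
          have "g (\<sigma> k) - g t0 \<noteq> 0"
            using \<sigma>(1)[of k] t0_ab path_eq_iff[of "\<sigma> k" t0] by auto
          then show ?case
            using secant[OF u(2), of "\<sigma> k"] \<sigma>(1)[of k] elim by (simp add: inner_sgn pos_le_divide_eq)
        qed
        then show ?thesis
          by (intro tendsto_lowerbound[OF tendsto_inner[OF tendsto_const lim]]) auto
      qed
      then show "0 < u \<bullet> w"
        using \<open>m > 0\<close> by simp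
    qed
    \<comment> \<open>Right tangents supply free directions at times decreasing to
      \<open>t0\<close>. These are free at \<open>t\<close> by \<open>after_t\<close>, and a limit
      of them is free at \<open>t0\<close> as well.\<close>
    obtain l where l: "l \<in> free t0" "l \<in> free t"
    proof -
      \<comment> \<open>\<open>Suc (Suc k)\<close> keeps \<open>\<sigma> k\<close> strictly below
        \<open>t\<close>, hence below \<open>b\<close>, where right tangents exist.\<close>
      define \<sigma> where "\<sigma> = (\<lambda>k. t0 + (t - t0) * inverse (real (Suc (Suc k))))"
      have \<sigma>: "t0 < \<sigma> k" "\<sigma> k < t" for k
      proof -
        show "t0 < \<sigma> k"
          using \<open>t0 < t\<close> by (simp add: \<sigma>_def)
        have "(t - t0) * inverse (real (Suc (Suc k))) < (t - t0) * 1"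
          using \<open>t0 < t\<close> by (intro mult_strict_left_mono) (auto simp: field_simps)
        then show "\<sigma> k < t"
          by (simp add: \<sigma>_def)
      qed
      have "(\<lambda>k. t0 + (t - t0) * inverse (real (Suc (Suc k)))) \<longlonglongrightarrow> t0 + (t - t0) * 0"
        by (intro tendsto_add tendsto_mult tendsto_const LIMSEQ_Suc[OF LIMSEQ_inverse_real_of_nat])
      then have \<sigma>_lim: "\<sigma> \<longlonglongrightarrow> t0"
        by (simp add: \<sigma>_def)
      have "\<exists>w. w \<in> free (\<sigma> k)" for k
        using right_tangents_nonempty[of "\<sigma> k"] right_tangents_subset_free[of "\<sigma> k"] \<sigma>[of k] t0 t by force
      then obtain w where w: "\<And>k. w k \<in> free (\<sigma> k)"
        by metis
      have "w k \<in> free t" for k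
        using after_t[OF \<sigma>(1) less_imp_le[OF \<sigma>(2)]] w by blast
      then obtain l r where r: "strict_mono r" "(w \<circ> r) \<longlonglongrightarrow> l" and l: "l \<in> free t"
        using compact_free[OF t] unfolding compact_def by metis
      have "l \<in> free t0"
      proof (rule free_limit)
        show "(\<lambda>k. \<sigma> (r k)) \<longlonglongrightarrow> t0"
          using LIMSEQ_subseq_LIMSEQ[OF \<sigma>_lim r(1)] by (simp add: o_def)
        show "\<sigma> (r k) \<in> {a..b}" for k
          using \<sigma>[of "r k"] t0 t by auto
        show "(w \<circ> r) k \<in> free (\<sigma> (r k))" for k
          using w by simp
      qed fact+
      then show thesis
        using l by (rule that)
    qed
    show ?thesis
    proof (rule ccontr)
      assume "\<not> ?thesis"
      then have ne: "(free t0 \<inter> free t) \<times> (free t0 - U) \<noteq> {}"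
        using l by auto
      have comp: "compact ((free t0 \<inter> free t) \<times> (free t0 - U))"
        using compact_free[OF t0_ab] compact_free[OF t] \<open>open U\<close>
        by (intro compact_Times compact_Int compact_diff)
      have "continuous_on ((free t0 \<inter> free t) \<times> (free t0 - U)) (\<lambda>x. dist (fst x) (snd x))"
        by (intro continuous_intros)
      from continuous_attains_inf[OF comp ne this] obtain x where x: "x \<in> (free t0 \<inter> free t) \<times> (free t0 - U)"
        and min: "\<And>y. y \<in> (free t0 \<inter> free t) \<times> (free t0 - U) \<Longrightarrow> dist (fst x) (snd x) \<le> dist (fst y) (snd y)"
        by blast
      \<comment> \<open>A closest pair of a direction shared with \<open>free t\<close> and one
        outside \<open>U\<close>. A free direction \<open>n\<close> closer to both either lies in
        \<open>U\<close>, so that it is free at \<open>t\<close> by \<open>near_t\<close> and may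
        replace \<open>p\<close>, or lies outside \<open>U\<close> and may replace \<open>q\<close>;
        either way the distance drops.\<close>
      define p q where "p = fst x" and "q = snd x"
      have pq: "p \<in> free t0" "p \<in> free t" "q \<in> free t0" "q \<notin> U"
        using x by (auto simp: p_def q_def)
      then have "p \<noteq> q"
        using free_U by blast
      then obtain n where n: "n \<in> free t0" "dist p n < dist p q" "dist n q < dist p q"
        using free_dirs_between[OF trace_props(2-5)[OF t0_ab] R_pos pq(1,3)] by blast
      show False
      proof (cases "n \<in> U")
        case True
        then show False
          using min[of "(n, q)"] n pq near_t by (simp add: p_def q_def)
      next
        case False
        then show False
          using min[of "(p, n)"] n pq by (simp add: p_def q_def)
      qed
    qed
  qed
  then have t0_A: "free s \<subseteq> U" if "s \<in> {t0..t}" for s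
    using that after[of s] by (cases "s = t0") auto
  show False
  proof (cases "t0 = a")
    case True
    \<comment> \<open>\<open>trace a\<close> is a single point on the boundary of every such disk,
      so all unit vectors are free, including two opposite ones.\<close>
    have "u \<in> U" if "norm u = 1" for u
    proof -
      have "u \<in> free t0"
        unfolding True free_iff using that by simp
      then show ?thesis
        using \<open>free t0 \<subseteq> U\<close> by blast
    qed
    then have "axis 1 1 \<in> U" "- axis 1 1 \<in> U"
      by simp_all
    then have "m / 2 < axis 1 1 \<bullet> - (axis 1 1 :: real^2)"
      by (rule U_inner) simp
    then show False
      using \<open>m > 0\<close> by (simp add: inner_axis)
  next
    case False
    then have "a < t0"
      using t0 by simp
    \<comment> \<open>Arbitrarily shortly before \<open>t0\<close> some free direction lies outside
      \<open>U\<close>; a limit of such directions is free at \<open>t0\<close> and still outside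
      the open set \<open>U\<close>. The halved step in \<open>s\<close> makes
      \<open>t0 - 1 / Suc k < s\<close> strict.\<close>
    have "\<exists>s u. s \<in> {a..<t0} \<and> t0 - 1 / Suc k < s \<and> u \<in> free s - U" for k
    proof -
      define s where "s = max a (t0 - 1 / (2 * Suc k))"
      have s: "s \<in> {a..<t0}" "t0 - 1 / Suc k < s"
        using \<open>a < t0\<close> by (auto simp: s_def less_max_iff_disj field_simps)
      have "s \<notin> A"
        using s bdd cInf_lower[of s A] by (auto simp: t0_def)
      moreover have "s \<in> {a..t}"
        using s t0 by auto
      ultimately obtain s' where "s' \<in> {s..t}" "\<not> free s' \<subseteq> U"
        unfolding A_def by blast
      moreover have "s' < t0"
        using calculation t0_A[of s'] by (auto simp: not_le[symmetric])
      ultimately show ?thesis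
        using s by (intro exI[of _ s']) auto
    qed
    then obtain \<sigma> u where \<sigma>: "\<And>k. \<sigma> k \<in> {a..<t0}" "\<And>k. t0 - 1 / Suc k < \<sigma> k"
      and u: "\<And>k. u k \<in> free (\<sigma> k)" "\<And>k. u k \<notin> U"
      by (metis DiffE)
    have \<sigma>_lim: "\<sigma> \<longlonglongrightarrow> t0"
    proof (rule tendsto_sandwich)
      show "\<forall>\<^sub>F k in sequentially. t0 - 1 / Suc k \<le> \<sigma> k" "\<forall>\<^sub>F k in sequentially. \<sigma> k \<le> t0"
        using \<sigma> by (auto intro!: always_eventually less_imp_le)
      have "(\<lambda>k. t0 - inverse (real (Suc k))) \<longlonglongrightarrow> t0 - 0"
        by (intro tendsto_diff tendsto_const LIMSEQ_inverse_real_of_nat)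
      then show "(\<lambda>k. t0 - 1 / Suc k) \<longlonglongrightarrow> t0"
        by (simp add: inverse_eq_divide)
    qed simp
    have "u k \<in> sphere 0 1" for k
      using free_norm[OF u(1)] by simp
    then obtain l r where r: "strict_mono r" "(u \<circ> r) \<longlonglongrightarrow> l"
      using compact_sphere[of "0::real^2" 1] unfolding compact_def by metis
    have "l \<in> free t0"
    proof (rule free_limit)
      show "(\<lambda>k. \<sigma> (r k)) \<longlonglongrightarrow> t0"
        using LIMSEQ_subseq_LIMSEQ[OF \<sigma>_lim r(1)] by (simp add: o_def)
      show "\<sigma> (r k) \<in> {a..b}" for k
        using \<sigma>(1)[of "r k"] t0_ab by auto
      show "(u \<circ> r) k \<in> free (\<sigma> (r k))" for k
        using u by simp
    qed fact+
    moreover have "l \<in> - U"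
      by (rule closed_sequentially[OF _ _ r(2)]) (use u(2) \<open>open U\<close> in \<open>auto simp: closed_Compl\<close>)
    ultimately show False
      using \<open>free t0 \<subseteq> U\<close> by blast
  qed
qed

lemma is_R_hull_trace:
  assumes "t \<in> {a..b}"
  shows "is_R_hull R (trace t) (disk_hull R (trace t))"
  using trace_props[OF assms] R_pos by (intro is_R_hull_disk_hull[where p = "g t"]) auto

end

subsection \<open>Normal cones and arc length\<close>

text \<open>The disk of a free direction misses the whole hull, so
  \<open>u \<bullet> (y - x)\<close> is at most quadratically small in \<open>norm (y - x)\<close>
  for hull points \<open>y\<close>; in the limit defining a tangent vector the quadratic term
  disappears.\<close>

lemma free_dirs_subset_normal_cone:
  assumes "R > 0"
  shows "free_dirs R K x \<subseteq> normal_cone (disk_hull R K) x"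
proof
  fix u assume u: "u \<in> free_dirs R K x"
  then have nu: "norm u = 1"
    by (simp add: free_dirs_def)
  have "x + R *\<^sub>R u \<in> far_centers R K"
    using u by (force simp: free_dirs_def far_centers_def)
  then have "disk_hull R K \<inter> ball (x + R *\<^sub>R u) R = {}"
    by (force simp: disk_hull_def)
  then have "u \<in> free_dirs R (disk_hull R K) x"
    using nu by (simp add: free_dirs_def)
  then have C: "2 * R * (u \<bullet> (y - x)) \<le> (norm (y - x))\<^sup>2" if "y \<in> disk_hull R K" for y
    using that \<open>R > 0\<close> by (simp add: free_dirs_iff)
  show "u \<in> normal_cone (disk_hull R K) x"
    unfolding normal_cone_def
  proof (intro CollectI ballI)
    fix v assume v: "v \<in> tangent_cone (disk_hull R K) x"
    have bound: "u \<bullet> v \<le> \<epsilon> * (norm v + \<epsilon>) / (2 * R) + \<epsilon>" if "\<epsilon> > 0" for \<epsilon>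
    proof -
      obtain y r where y: "y \<in> disk_hull R K" "norm (y - x) < \<epsilon>"
        and r: "r > 0" "norm (r *\<^sub>R (y - x) - v) < \<epsilon>"
        using v \<open>\<epsilon> > 0\<close> unfolding tangent_cone_def by blast
      have "r * norm (y - x) \<le> norm v + \<epsilon>"
        using norm_triangle_ineq[of "r *\<^sub>R (y - x) - v" v] r by simp
      then have "norm (y - x) * (r * norm (y - x)) \<le> \<epsilon> * (norm v + \<epsilon>)"
        using y(2) r(1) \<open>\<epsilon> > 0\<close> by (intro mult_mono) auto
      moreover have "r * (2 * R * (u \<bullet> (y - x))) \<le> r * (norm (y - x))\<^sup>2"
        using C[OF y(1)] r(1) by simp
      ultimately have "2 * R * (u \<bullet> (r *\<^sub>R (y - x))) \<le> \<epsilon> * (norm v + \<epsilon>)"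
        by (simp add: power2_eq_square mult_ac)
      then have "u \<bullet> (r *\<^sub>R (y - x)) \<le> \<epsilon> * (norm v + \<epsilon>) / (2 * R)"
        using \<open>R > 0\<close> by (simp add: field_simps)
      moreover have "u \<bullet> (v - r *\<^sub>R (y - x)) \<le> \<epsilon>"
        using norm_cauchy_schwarz[of u "v - r *\<^sub>R (y - x)"] nu r(2) by (simp add: norm_minus_commute)
      ultimately show ?thesis
        by (simp add: inner_diff_right)
    qed
    have "((\<lambda>\<epsilon>. \<epsilon> * (norm v + \<epsilon>) / (2 * R) + \<epsilon>) \<longlongrightarrow> 0 * (norm v + 0) / (2 * R) + 0) (at_right 0)"
      by (intro tendsto_intros) (use \<open>R > 0\<close> in auto)
    then have "((\<lambda>\<epsilon>. \<epsilon> * (norm v + \<epsilon>) / (2 * R) + \<epsilon>) \<longlongrightarrow> 0) (at_right 0)"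
      by simp
    moreover have "\<forall>\<^sub>F \<epsilon> in at_right 0. u \<bullet> v \<le> \<epsilon> * (norm v + \<epsilon>) / (2 * R) + \<epsilon>"
      using eventually_at_right_less[of "0::real"] by eventually_elim (rule bound)
    ultimately show "u \<bullet> v \<le> 0"
      by (rule tendsto_lowerbound) simp
  qed
qed

lemma normal_cone_add_scaleR:
  assumes "u \<in> normal_cone K x" "v \<in> normal_cone K x" "0 \<le> \<alpha>" "0 \<le> \<beta>"
  shows "\<alpha> *\<^sub>R u + \<beta> *\<^sub>R v \<in> normal_cone K x"
  unfolding normal_cone_def
proof (intro CollectI ballI)
  fix w assume "w \<in> tangent_cone K x"
  then have "u \<bullet> w \<le> 0" "v \<bullet> w \<le> 0"
    using assms(1,2) by (simp_all add: normal_cone_def)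
  then have "\<alpha> * (u \<bullet> w) \<le> 0" "\<beta> * (v \<bullet> w) \<le> 0"
    using assms(3,4) by (simp_all add: mult_nonneg_nonpos)
  then show "(\<alpha> *\<^sub>R u + \<beta> *\<^sub>R v) \<bullet> w \<le> 0"
    by (simp add: inner_add_left)
qed

lemma closed_normal_cone: "closed (normal_cone K x)"
proof -
  have "normal_cone K x = (\<Inter>v\<in>tangent_cone K x. {u. u \<bullet> v \<le> 0})"
    by (auto simp: normal_cone_def)
  moreover have "closed {u. u \<bullet> v \<le> 0}" for v :: 'a
    by (intro closed_Collect_le continuous_intros)
  ultimately show ?thesis
    by auto
qed

text \<open>\<open>E\<close> contains the quarter circle from \<open>u\<close> counterclockwise to
  \<open>perp u\<close>. Its angles form an interval of length \<open>pi / 2\<close>, which is split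
  in two if it passes \<open>2 * pi\<close>.\<close>

lemma arc_length_quarter:
  assumes "closed E" and u: "norm u = 1"
    and E: "\<And>\<tau>. 0 \<le> \<tau> \<Longrightarrow> \<tau> \<le> pi / 2 \<Longrightarrow> cos \<tau> *\<^sub>R u + sin \<tau> *\<^sub>R perp u \<in> E"
  shows "pi / 2 \<le> arc_length E"
proof -
  define h where "h \<theta> = (vector [cos \<theta>, sin \<theta>] :: real^2)" for \<theta>
  have h_nth: "h \<theta> $ 1 = cos \<theta>" "h \<theta> $ 2 = sin \<theta>" for \<theta>
    by (simp_all add: h_def)
  have "(u $ 1)\<^sup>2 + (u $ 2)\<^sup>2 = 1"
    using u by (simp add: norm_eq_sqrt_inner inner_real2 power2_eq_square)
  then obtain \<theta> where \<theta>: "0 \<le> \<theta>" "\<theta> < 2 * pi" "u $ 1 = cos \<theta>" "u $ 2 = sin \<theta>"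
    using sincos_total_2pi by blast
  have h_add: "h (\<theta> + \<tau>) = cos \<tau> *\<^sub>R u + sin \<tau> *\<^sub>R perp u" for \<tau>
    by (simp add: vec2_eq_iff h_nth \<theta> cos_add sin_add algebra_simps)
  have h_period: "h (\<theta>' - 2 * pi) = h \<theta>'" for \<theta>'
    by (simp add: vec2_eq_iff h_nth cos_diff sin_diff)
  define S where "S = {\<theta> \<in> {0..<2*pi}. h \<theta> \<in> E}"
  have "h = (\<lambda>\<theta>. cos \<theta> *\<^sub>R axis 1 1 + sin \<theta> *\<^sub>R axis 2 1)"
    by (simp add: fun_eq_iff vec2_eq_iff h_nth axis_def)
  then have "continuous_on UNIV h"
    by (simp add: continuous_intros)
  then have "closed (h -` E)"
    by (rule closed_vimage[OF \<open>closed E\<close>])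
  then have "h -` E \<in> sets lebesgue"
    by (intro sets_completionI_sets) simp
  then have "{0..<2*pi} \<inter> h -` E \<in> sets lebesgue"
    by (intro sets.Int) simp_all
  moreover have "{0..<2*pi} \<inter> h -` E = S"
    by (auto simp: S_def)
  moreover have "bounded S"
    by (rule bounded_subset[of "{0..2*pi}"]) (auto simp: S_def)
  ultimately have "S \<in> lmeasurable"
    by (simp add: bounded_set_imp_lmeasurable)
  have E': "h (\<theta> + \<tau>) \<in> E" if "0 \<le> \<tau>" "\<tau> \<le> pi / 2" for \<tau>
    using E[OF that] by (simp add: h_add)
  have "pi / 2 \<le> measure lebesgue S"
  proof (cases "\<theta> + pi / 2 \<le> 2 * pi")
    case True
    \<comment> \<open>The right end is left out because it may equal \<open>2 * pi\<close>, which is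
      not among the angles counted.\<close>
    have "{\<theta>..<\<theta> + pi / 2} \<subseteq> S"
    proof
      fix s assume "s \<in> {\<theta>..<\<theta> + pi / 2}"
      then show "s \<in> S"
        using E'[of "s - \<theta>"] \<theta> True by (auto simp: S_def)
    qed
    then have "measure lebesgue {\<theta>..<\<theta> + pi / 2} \<le> measure lebesgue S"
      using \<open>S \<in> lmeasurable\<close> by (intro measure_mono_fmeasurable) auto
    then show ?thesis
      by simp
  next
    case False
    have "{\<theta>..<2 * pi} \<union> {0..<\<theta> + pi / 2 - 2 * pi} \<subseteq> S"
    proof
      fix s assume s: "s \<in> {\<theta>..<2 * pi} \<union> {0..<\<theta> + pi / 2 - 2 * pi}"
      then consider "\<theta> \<le> s" "s < 2 * pi" | "0 \<le> s" "s < \<theta> + pi / 2 - 2 * pi"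
        by auto
      then show "s \<in> S"
      proof cases
        case 1
        then show ?thesis
          using E'[of "s - \<theta>"] \<theta> False by (auto simp: S_def)
      next
        case 2
        then have "h (s + 2 * pi) \<in> E"
          using E'[of "s + 2 * pi - \<theta>"] \<theta> by auto
        then have "h s \<in> E"
          using h_period[of "s + 2 * pi"] by simp
        then show ?thesis
          using 2 \<theta> by (auto simp: S_def)
      qed
    qed
    then have "measure lebesgue ({\<theta>..<2 * pi} \<union> {0..<\<theta> + pi / 2 - 2 * pi}) \<le> measure lebesgue S"
      using \<open>S \<in> lmeasurable\<close> by (intro measure_mono_fmeasurable) auto
    moreover have "measure lebesgue ({\<theta>..<2 * pi} \<union> {0..<\<theta> + pi / 2 - 2 * pi}) =
        measure lebesgue {\<theta>..<2 * pi} + measure lebesgue {0..<\<theta> + pi / 2 - 2 * pi}"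
    proof (rule measure_Union)
      have "0 \<le> \<theta> - 3 * pi / 2"
        using False by simp
      then show "emeasure lebesgue {0..<\<theta> + pi / 2 - 2 * pi} \<noteq> \<infinity>"
        by simp
    qed (use \<theta> in auto)
    ultimately show ?thesis
      using \<theta> False by simp
  qed
  then show ?thesis
    by (simp add: arc_length_def S_def h_def)
qed

text \<open>In the plane \<open>v\<close> is \<open>perp u\<close> or \<open>- perp u\<close>; in
  the second case \<open>u = perp v\<close>. Either way the convex cone contains a quadrant in the
  orientation required by \<open>arc_length_quarter\<close>.\<close>

lemma arc_length_normal_cone:
  fixes u v :: "real^2"
  assumes uv: "u \<in> normal_cone K x" "v \<in> normal_cone K x" "norm u = 1" "norm v = 1" "u \<bullet> v = 0"
  shows "pi / 2 \<le> arc_length (normal_cone K x \<inter> sphere 0 1)"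
proof -
  have quarter: "pi / 2 \<le> arc_length (normal_cone K x \<inter> sphere 0 1)"
    if u: "u \<in> normal_cone K x" "perp u \<in> normal_cone K x" "norm u = 1" for u
  proof (rule arc_length_quarter)
    show "closed (normal_cone K x \<inter> sphere 0 1)"
      by (intro closed_Int closed_normal_cone closed_sphere)
    show "norm u = 1"
      by fact
    fix \<tau> :: real assume \<tau>: "0 \<le> \<tau>" "\<tau> \<le> pi / 2"
    have "0 \<le> cos \<tau>" "0 \<le> sin \<tau>"
      using \<tau> by (auto intro: cos_ge_zero sin_ge_zero)
    then have "cos \<tau> *\<^sub>R u + sin \<tau> *\<^sub>R perp u \<in> normal_cone K x"
      using u by (intro normal_cone_add_scaleR)
    moreover have "(norm (cos \<tau> *\<^sub>R u + sin \<tau> *\<^sub>R perp u))\<^sup>2 = 1"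
      using frame_norm[OF u(3), of "cos \<tau> *\<^sub>R u + sin \<tau> *\<^sub>R perp u"] u(3)
      by (simp add: inner_simps dot_square_norm)
    then have "norm (cos \<tau> *\<^sub>R u + sin \<tau> *\<^sub>R perp u) = 1"
      by (simp add: power2_eq_1_iff) (metis norm_ge_zero not_one_le_zero neg_0_le_iff_le)
    ultimately show "cos \<tau> *\<^sub>R u + sin \<tau> *\<^sub>R perp u \<in> normal_cone K x \<inter> sphere 0 1"
      by simp
  qed
  have "v = (v \<bullet> perp u) *\<^sub>R perp u"
    using frame_expand[OF uv(3), of v] uv(5) by (simp add: inner_commute)
  moreover from this have "\<bar>v \<bullet> perp u\<bar> = 1"
    using uv(3,4) by (metis norm_perp norm_scaleR mult.right_neutral real_norm_def)
  ultimately consider "v = perp u" | "v = - perp u"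
    by (metis abs_if minus_minus scaleR_minus1_left scaleR_one)
  then show ?thesis
  proof cases
    case 1
    then show ?thesis
      using quarter[of u] uv by simp
  next
    case 2
    then have "perp v = u"
      by (simp add: vec2_eq_iff)
    then show ?thesis
      using quarter[of v] uv by simp
  qed
qed

theorem theorem4p3:
  fixes R a b :: real and g :: "real \<Rightarrow> real^2"
  assumes "R > 0"
    and "R_path R a b g"
    and "inj_on g {a..b}"
    and "\<forall>t\<in>{a..b}. g ` {a..t} \<subseteq> ball (g t) R"
  shows "\<forall>t\<in>{a..b}.
    arc_length (normal_cone (R_hull R (g ` {a..t})) (g t) \<inter> sphere 0 1) \<ge> pi / 2"
proof
  interpret injective_R_path R a b g
    by unfold_locales (use assms in auto)
  fix t assume t: "t \<in> {a..b}"
  define C where "C = disk_hull R (trace t)"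
  have hull: "R_hull R (trace t) = C"
    unfolding C_def by (rule R_hull_eqI) (rule is_R_hull_trace[OF t])
  have sub: "free t \<subseteq> normal_cone C (g t)"
    unfolding C_def using R_pos by (rule free_dirs_subset_normal_cone)
  obtain u v where uv: "u \<in> free t" "v \<in> free t" "u \<bullet> v \<le> 0"
    using free_not_acute[OF t] by blast
  then have nrm: "norm u = 1" "norm v = 1"
    by (simp_all add: free_norm)
  \<comment> \<open>By \<open>arc_length_normal_cone\<close> a unit normal orthogonal to
    \<open>u\<close> suffices. If \<open>v = - u\<close>, such a direction is even free.\<close>
  have "\<exists>w\<in>normal_cone C (g t). norm w = 1 \<and> u \<bullet> w = 0"
  proof (cases "v = - u")
    case True
    then obtain w where w: "w \<in> free t" "w \<bullet> u = 0"
      using free_dirs_antipodal[OF trace_props(3,5)[OF t] R_pos uv(1)] uv(2) by blast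
    then show ?thesis
      using sub free_norm[OF w(1)] by (auto simp: inner_commute)
  next
    case False
    \<comment> \<open>Gram-Schmidt: the coefficient \<open>- (u \<bullet> v)\<close> is nonnegative,
      so \<open>w\<close> stays in the convex cone; it could vanish only for
      \<open>v = - u\<close>.\<close>
    define w where "w = (- (u \<bullet> v)) *\<^sub>R u + 1 *\<^sub>R v"
    have "w \<in> normal_cone C (g t)"
      unfolding w_def using uv sub by (intro normal_cone_add_scaleR) auto
    then have "inverse (norm w) *\<^sub>R w + 0 *\<^sub>R w \<in> normal_cone C (g t)"
      by (intro normal_cone_add_scaleR) auto
    then have "sgn w \<in> normal_cone C (g t)"
      by (simp add: sgn_div_norm)
    moreover have "u \<bullet> w = 0"
      using nrm by (simp add: w_def inner_simps dot_square_norm)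
    then have "u \<bullet> sgn w = 0"
      by (simp add: inner_sgn)
    moreover have "w \<noteq> 0"
    proof
      assume "w = 0"
      then have v: "v = (u \<bullet> v) *\<^sub>R u"
        by (simp add: w_def)
      then have "\<bar>u \<bullet> v\<bar> = 1"
        using nrm by (metis norm_scaleR mult.right_neutral)
      then have "u \<bullet> v = -1"
        using uv(3) by simp
      then show False
        using v False by simp
    qed
    then have "norm (sgn w) = 1"
      by (simp add: norm_sgn)
    ultimately show ?thesis
      by blast
  qed
  then obtain w where "w \<in> normal_cone C (g t)" "norm w = 1" "u \<bullet> w = 0"
    by blast
  then show "pi / 2 \<le> arc_length (normal_cone (R_hull R (trace t)) (g t) \<inter> sphere 0 1)"
    unfolding hull using uv(1) sub nrm(1) by (intro arc_length_normal_cone[of u _ _ w]) auto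
qed

end
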